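(* Let $(\Gamma,\alpha)$ be an abstract 1-skeleton of type $(k,n)$ with $\Gamma$ connected such that $\alpha$ is at least three independent (i.e. $l$-independent for some $l$ with $3\le l\le k$). If the intersection of any two faces of dimension less than $3$ in $(\Gamma,\alpha)$ is either connected or empty, then $\Gamma$ is $n$-connected.
   Context: Let $G=(\mathbb{Z}_2)^k$, $k\ge1$. $\mathrm{Hom}(G,\mathbb{Z}_2)$ is regarded as a $k$-dimensional vector space over $\mathbb{Z}_2$ with zero element $\rho_0$. An abstract 1-skeleton of type $(k,n)$ (with $n\ge k$) is a pair $(\Gamma,\alpha)$ where $\Gamma$ is a finite $n$-valent regular graph without loops (multiple edges allowed), with vertex set $V_\Gamma$ and edge set $E_\Gamma$, and $\alpha:E_\Gamma\to\mathrm{Hom}(G,\mathbb{Z}_2)\setminus\{\rho_0\}$ is a map such that, with $E_p$ the set of edges adjacent to the vertex $p$ and $\alpha(E_p)$ the multiset of values of $\alpha$ on $E_p$: (1) for each $p\in V_\Gamma$, $\alpha(E_p)$ spans $\mathrm{Hom}(G,\mathbb{Z}_2)$; (2) for each edge $e$ with endpoints $p,q$, $\alpha(E_p)\equiv\alpha(E_q)\bmod\alpha(e)$, i.e. the two multisets have the same image in $\mathrm{Hom}(G,\mathbb{Z}_2)/\langle\alpha(e)\rangle$. $\alpha$ is $l$-independent if for each vertex $p$ the colors of any $l$ distinct edges in $E_p$ are linearly independent in $\mathrm{Hom}(G,\mathbb{Z}_2)$. For $0\le\ell\le n$, an $\ell$-dimensional face ($\ell$-face) of $(\Gamma,\alpha)$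 is a pair $(\Gamma',\alpha|_{\Gamma'})$ with $\Gamma'$ a connected $\ell$-valent subgraph of $\Gamma$ for which there is a subspace $K$ of $\mathrm{Hom}(G,\mathbb{Z}_2)$ such that (writing $E_p|_{\Gamma'}$ for the edges of $\Gamma'$ adjacent to $p$) (1) for each vertex $p\in V_{\Gamma'}$, $\alpha(E_p|_{\Gamma'})$ spans $K$, and (2) for each edge $e=pq$ of $\Gamma'$, $\alpha(E_p|_{\Gamma'})\equiv\alpha(E_q|_{\Gamma'})\bmod\alpha(e)$ as multisets. Each vertex is a $0$-face. Intersections of faces are intersections of subgraphs (common vertices and common edges). A path in $\Gamma$ with endpoints $a,b$ is a subgraph with vertices $v_0=a,v_1,\dots,v_l=b$ and edges $v_{i-1}v_i$, $i=1,\dots,l$. Two paths with common endpoints $a,b$ are disjoint if their intersection consists of $a$ and $b$ only. A graph is $d$-connected if for every pair of (distinct) vertices there exist $d$ pairwise disjoint paths in it having these vertices as endpoints. *)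

theory Defs
  imports
    "HOL-Analysis.Finite_Cartesian_Product"
    "HOL-Library.Z2"
    "HOL-Library.Multiset"
    "HOL-Library.Function_Algebras"
begin

section \<open>The vector space of homomorphisms to the two-element field\<close>

text \<open>
  The group \<open>(\<int>\<^sub>2)\<^sup>k\<close> is the additive group of \<^typ>\<open>bit ^ 'k\<close>, with \<open>k = CARD('k)\<close>; its
  homomorphisms to \<open>\<int>\<^sub>2\<close> form a subspace of the space of all functions to \<^typ>\<open>bit\<close>, whose
  pointwise addition and zero come from \<^theory>\<open>HOL-Library.Function_Algebras\<close>.
\<close>

definition bscale :: "bit \<Rightarrow> ('a \<Rightarrow> bit) \<Rightarrow> ('a \<Rightarrow> bit)" where
  "bscale c f = (\<lambda>x. c * f x)"

global_interpretation Z2fun: vector_space bscale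
  defines Z2_subspace = Z2fun.subspace
    and Z2_span = Z2fun.span
    and Z2_dependent = Z2fun.dependent
  by unfold_locales (auto simp: bscale_def fun_eq_iff algebra_simps)

definition Hom_Z2 :: "(bit ^ 'k \<Rightarrow> bit) set" where
  "Hom_Z2 = {\<rho>. \<forall>x y. \<rho> (x + y) = \<rho> x + \<rho> y}"

lemma subspace_Hom_Z2: "Z2_subspace Hom_Z2"
  by (auto simp: Z2fun.subspace_def Hom_Z2_def bscale_def algebra_simps)

text \<open>The class of \<open>\<rho>\<close> in the quotient by the line spanned by \<open>c\<close>, as a coset.\<close>

definition class_mod :: "('a \<Rightarrow> bit) \<Rightarrow> ('a \<Rightarrow> bit) \<Rightarrow> ('a \<Rightarrow> bit) set" where
  "class_mod c \<rho> = (\<lambda>\<sigma>. \<rho> + \<sigma>) ` Z2_span {c}"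

definition mset_cong_mod ::
    "('a \<Rightarrow> bit) \<Rightarrow> ('a \<Rightarrow> bit) multiset \<Rightarrow> ('a \<Rightarrow> bit) multiset \<Rightarrow> bool" where
  "mset_cong_mod c M N \<longleftrightarrow> image_mset (class_mod c) M = image_mset (class_mod c) N"


section \<open>Finite loopless multigraphs\<close>

record ('v, 'e) mgraph =
  verts :: "'v set"
  edges :: "'e set"
  ends :: "'e \<Rightarrow> 'v set"

definition multigraph :: "('v, 'e) mgraph \<Rightarrow> bool" where
  "multigraph \<Gamma> \<longleftrightarrow> finite (verts \<Gamma>) \<and> finite (edges \<Gamma>) \<and>
     (\<forall>e\<in>edges \<Gamma>. ends \<Gamma> e \<subseteq> verts \<Gamma> \<and> card (ends \<Gamma> e) = 2)"

definition edges_at :: "('v, 'e) mgraph \<Rightarrow> 'v \<Rightarrow> 'e set" where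
  "edges_at \<Gamma> p = {e \<in> edges \<Gamma>. p \<in> ends \<Gamma> e}"

definition valent :: "nat \<Rightarrow> ('v, 'e) mgraph \<Rightarrow> bool" where
  "valent n \<Gamma> \<longleftrightarrow> (\<forall>p\<in>verts \<Gamma>. card (edges_at \<Gamma> p) = n)"

definition subgraph :: "('v, 'e) mgraph \<Rightarrow> ('v, 'e) mgraph \<Rightarrow> bool" where
  "subgraph H \<Gamma> \<longleftrightarrow> verts H \<subseteq> verts \<Gamma> \<and> edges H \<subseteq> edges \<Gamma> \<and> ends H = ends \<Gamma> \<and>
     (\<forall>e\<in>edges H. ends H e \<subseteq> verts H)"

text \<open>Only meant for two subgraphs of one graph, which share their \<^const>\<open>ends\<close> function.\<close>

definition graph_inter :: "('v, 'e) mgraph \<Rightarrow> ('v, 'e) mgraph \<Rightarrow> ('v, 'e) mgraph" where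
  "graph_inter H H' =
     \<lparr>verts = verts H \<inter> verts H', edges = edges H \<inter> edges H', ends = ends H\<rparr>"

definition empty_graph :: "('v, 'e) mgraph \<Rightarrow> bool" where
  "empty_graph \<Gamma> \<longleftrightarrow> verts \<Gamma> = {} \<and> edges \<Gamma> = {}"

text \<open>The empty graph does not count as connected.\<close>

definition connected_graph :: "('v, 'e) mgraph \<Rightarrow> bool" where
  "connected_graph \<Gamma> \<longleftrightarrow> verts \<Gamma> \<noteq> {} \<and>
     (\<forall>p\<in>verts \<Gamma>. \<forall>q\<in>verts \<Gamma>. (p, q) \<in> {(u, v). \<exists>e\<in>edges \<Gamma>. ends \<Gamma> e = {u, v}}\<^sup>*)"

definition path_between :: "('v, 'e) mgraph \<Rightarrow> 'v \<Rightarrow> 'v \<Rightarrow> ('v, 'e) mgraph \<Rightarrow> bool" where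
  "path_between \<Gamma> a b P \<longleftrightarrow> subgraph P \<Gamma> \<and>
     (\<exists>vs es. length vs = Suc (length es) \<and> distinct vs \<and> hd vs = a \<and> last vs = b \<and>
        (\<forall>i<length es. ends \<Gamma> (es ! i) = {vs ! i, vs ! Suc i}) \<and>
        verts P = set vs \<and> edges P = set es)"

text \<open>
  Disjointness also concerns edges: two paths running along one and the same edge
  from \<open>a\<close> to \<open>b\<close> are not disjoint, whereas parallel edges yield disjoint paths.
\<close>

definition disjoint_paths :: "'v \<Rightarrow> 'v \<Rightarrow> ('v, 'e) mgraph \<Rightarrow> ('v, 'e) mgraph \<Rightarrow> bool" where
  "disjoint_paths a b P Q \<longleftrightarrow>
     verts (graph_inter P Q) = {a, b} \<and> edges (graph_inter P Q) = {}"

definition d_connected :: "nat \<Rightarrow> ('v, 'e) mgraph \<Rightarrow> bool" where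
  "d_connected d \<Gamma> \<longleftrightarrow> (\<forall>a\<in>verts \<Gamma>. \<forall>b\<in>verts \<Gamma>. a \<noteq> b \<longrightarrow>
     (\<exists>P. (\<forall>i<d. path_between \<Gamma> a b (P i)) \<and>
          (\<forall>i<d. \<forall>j<d. i \<noteq> j \<longrightarrow> disjoint_paths a b (P i) (P j))))"


section \<open>Abstract 1-skeletons and their faces\<close>

definition colors_at ::
    "('v, 'e) mgraph \<Rightarrow> ('e \<Rightarrow> 'a \<Rightarrow> bit) \<Rightarrow> 'v \<Rightarrow> ('a \<Rightarrow> bit) multiset" where
  "colors_at \<Gamma> \<alpha> p = image_mset \<alpha> (mset_set (edges_at \<Gamma> p))"

definition colors_cong ::
    "('v, 'e) mgraph \<Rightarrow> ('e \<Rightarrow> 'a \<Rightarrow> bit) \<Rightarrow> bool" where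
  "colors_cong \<Gamma> \<alpha> \<longleftrightarrow> (\<forall>e\<in>edges \<Gamma>. \<forall>p q. ends \<Gamma> e = {p, q} \<longrightarrow>
     mset_cong_mod (\<alpha> e) (colors_at \<Gamma> \<alpha> p) (colors_at \<Gamma> \<alpha> q))"

text \<open>Type \<open>(k, n)\<close> with \<open>k = CARD('k)\<close>.\<close>

definition abstract_1_skeleton ::
    "nat \<Rightarrow> ('v, 'e) mgraph \<Rightarrow> ('e \<Rightarrow> bit ^ 'k \<Rightarrow> bit) \<Rightarrow> bool" where
  "abstract_1_skeleton n \<Gamma> \<alpha> \<longleftrightarrow>
     CARD('k) \<le> n \<and> multigraph \<Gamma> \<and> valent n \<Gamma> \<and>
     (\<forall>e\<in>edges \<Gamma>. \<alpha> e \<in> Hom_Z2 - {0}) \<and>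
     (\<forall>p\<in>verts \<Gamma>. Z2_span (set_mset (colors_at \<Gamma> \<alpha> p)) = Hom_Z2) \<and>
     colors_cong \<Gamma> \<alpha>"

text \<open>
  Injectivity is needed because linear independence is that of the family of
  colors, so two edges of the same color are dependent.
\<close>

definition l_independent :: "nat \<Rightarrow> ('v, 'e) mgraph \<Rightarrow> ('e \<Rightarrow> 'a \<Rightarrow> bit) \<Rightarrow> bool" where
  "l_independent l \<Gamma> \<alpha> \<longleftrightarrow> (\<forall>p\<in>verts \<Gamma>. \<forall>S. S \<subseteq> edges_at \<Gamma> p \<and> card S = l \<longrightarrow>
     inj_on \<alpha> S \<and> \<not> Z2_dependent (\<alpha> ` S))"

text \<open>
  A face is determined by its underlying subgraph, its coloring being the restriction of \<open>\<alpha>\<close>;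
  it therefore is represented by the subgraph.  The bound \<open>l \<le> n\<close> on the dimension of a face of an
  \<open>n\<close>-valent graph is automatic, as a face has at least one vertex.
\<close>

definition face :: "nat \<Rightarrow> ('v, 'e) mgraph \<Rightarrow> ('e \<Rightarrow> bit ^ 'k \<Rightarrow> bit) \<Rightarrow> ('v, 'e) mgraph \<Rightarrow> bool" where
  "face l \<Gamma> \<alpha> F \<longleftrightarrow> subgraph F \<Gamma> \<and> connected_graph F \<and> valent l F \<and>
     (\<exists>K. Z2_subspace K \<and> K \<subseteq> Hom_Z2 \<and>
        (\<forall>p\<in>verts F. Z2_span (set_mset (colors_at F \<alpha> p)) = K)) \<and>
     colors_cong F \<alpha>"

end

theory Submission
  imports Defs
begin

text \<open>
  By Menger's theorem it suffices that no set of fewer than \<open>n\<close> vertices separates \<open>\<Gamma>\<close>.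
  Three-independence makes any two edges at a vertex span a 2-face, a component of the subgraph of
  edges whose color lies in the plane of their two colors.  The hypothesis on intersections forces
  \<open>\<Gamma>\<close> to be simple, 2-faces to be induced, and two distinct 2-faces to share at most a vertex or
  an edge.  Let \<open>S\<close> be a minimal separator, with sides \<open>A\<close> and \<open>B\<close>, and \<open>s \<in> S\<close> with \<open>x\<close>, \<open>y\<close>, \<open>z\<close> edges
  into \<open>A\<close>, \<open>B\<close>, \<open>S\<close>.  Each of the \<open>x y\<close> 2-faces entering \<open>s\<close> from \<open>A\<close> and leaving to \<open>B\<close> meets \<open>S\<close> in
  another vertex; these vertices are distinct and not adjacent to \<open>s\<close>, so
  \<open>card S \<ge> 1 + x y + z \<ge> x + y + z = n\<close>.
\<close>

section \<open>Menger's theorem\<close>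

text \<open>Directed walks: vertices may repeat, and a single vertex of \<open>A \<inter> B\<close>
  is a walk from \<open>A\<close> to \<open>B\<close>. Distinctness is demanded only in
  \<open>linkage\<close>.\<close>

definition path_from_to :: "'v rel \<Rightarrow> 'v set \<Rightarrow> 'v set \<Rightarrow> 'v list \<Rightarrow> bool" where
  "path_from_to E A B xs \<longleftrightarrow> xs \<noteq> [] \<and> successively (\<lambda>u v. (u, v) \<in> E) xs \<and> hd xs \<in> A \<and> last xs \<in> B"

definition separates :: "'v rel \<Rightarrow> 'v set \<Rightarrow> 'v set \<Rightarrow> 'v set \<Rightarrow> bool" where
  "separates E A B S \<longleftrightarrow> (\<forall>xs. path_from_to E A B xs \<longrightarrow> set xs \<inter> S \<noteq> {})"

definition linkage :: "'v rel \<Rightarrow> 'v set \<Rightarrow> 'v set \<Rightarrow> 'v list set \<Rightarrow> bool" where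
  "linkage E A B Ps \<longleftrightarrow> (\<forall>xs\<in>Ps. path_from_to E A B xs \<and> distinct xs) \<and>
     (\<forall>xs\<in>Ps. \<forall>ys\<in>Ps. xs \<noteq> ys \<longrightarrow> set xs \<inter> set ys = {})"

lemma path_shorten:
  assumes "path_from_to E A B xs"
  shows "\<exists>ys. path_from_to E A B ys \<and> distinct ys \<and> set ys \<subseteq> set xs"
  using assms
proof (induction xs rule: length_induct)
  case (1 xs)
  show ?case
  proof (cases "distinct xs")
    case True
    with 1 show ?thesis by blast
  next
    case False
    then obtain as bs cs y where xs: "xs = as @ [y] @ bs @ [y] @ cs"
      using not_distinct_decomp by blast
    have "path_from_to E A B (as @ [y] @ cs)"
      using 1(2) unfolding xs path_from_to_def
      by (cases as) (auto simp: successively_append_iff successively_Cons hd_append split: if_splits)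
    moreover have "length (as @ [y] @ cs) < length xs" "set (as @ [y] @ cs) \<subseteq> set xs"
      unfolding xs by auto
    ultimately show ?thesis using 1(1) by (meson subset_trans)
  qed
qed

text \<open>Cutting out detours only shrinks the vertex sets, so disjointness survives, and disjoint
  nonempty lists are different. Linkages can thus be built from walks not known to be paths.\<close>

lemma linkage_of_disjoint_paths:
  assumes path: "\<And>i. i \<in> I \<Longrightarrow> path_from_to E A B (f i)"
    and disj: "\<And>i j. i \<in> I \<Longrightarrow> j \<in> I \<Longrightarrow> i \<noteq> j \<Longrightarrow> set (f i) \<inter> set (f j) = {}"
  shows "\<exists>Ps. linkage E A B Ps \<and> card Ps = card I"
proof -
  obtain g where g: "\<And>i. i \<in> I \<Longrightarrow> path_from_to E A B (g i) \<and> distinct (g i) \<and> set (g i) \<subseteq> set (f i)"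
    using path_shorten[OF path] by metis
  have gdisj: "set (g i) \<inter> set (g j) = {}" if "i \<in> I" "j \<in> I" "i \<noteq> j" for i j
    using conjunct2[OF conjunct2[OF g[OF that(1)]]] conjunct2[OF conjunct2[OF g[OF that(2)]]]
      disj[OF that] by fast
  have "inj_on g I"
  proof (rule inj_onI, rule ccontr)
    fix i j assume ij: "i \<in> I" "j \<in> I" "g i = g j" "i \<noteq> j"
    then have "set (g i) = {}" using gdisj[of i j] by auto
    with g[OF ij(1)] show False by (auto simp: path_from_to_def)
  qed
  then have "card (g ` I) = card I" by (rule card_image)
  moreover have "linkage E A B (g ` I)"
    unfolding linkage_def using g gdisj by (metis (no_types, lifting) imageE)
  ultimately show ?thesis by blast
qed

lemma successively_rel_mono:
  assumes "successively (\<lambda>u v. (u, v) \<in> F) xs" "F \<subseteq> E"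
  shows "successively (\<lambda>u v. (u, v) \<in> E) xs"
  using assms(1) by (rule successively_mono) (use assms(2) in auto)

lemma linkage_mono: "linkage F A B Ps \<Longrightarrow> F \<subseteq> E \<Longrightarrow> linkage E A B Ps"
  unfolding linkage_def path_from_to_def
  by (simp add: successively_rel_mono[of F _ E])

text \<open>Disjoint paths have different vertices \<open>h xs\<close>, and there are as many paths
  as elements of \<open>T\<close>. With \<open>last\<close> or \<open>hd\<close> as
  \<open>h\<close>, this indexes the paths by \<open>T\<close>.\<close>

lemma linkage_endpoint_bij:
  assumes "linkage E A B Ps"
    and end_mem: "\<And>xs. path_from_to E A B xs \<Longrightarrow> h xs \<in> set xs \<inter> T"
    and "finite T" "card Ps = card T"
  shows "bij_betw h Ps T"
proof -
  have *: "h xs \<in> set xs \<inter> T" if "xs \<in> Ps" for xs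
    using assms(1) end_mem that unfolding linkage_def by blast
  have inj: "inj_on h Ps"
    using assms(1) * unfolding linkage_def inj_on_def by (metis IntD1 disjoint_iff)
  moreover have "h ` Ps = T"
    using card_subset_eq[OF \<open>finite T\<close>, of "h ` Ps"] * card_image[OF inj] assms(4) by auto
  ultimately show ?thesis by (simp add: bij_betw_def)
qed

lemma linkage_indexed_by_ends:
  assumes "linkage E A T Ps" "finite T" "card Ps = card T"
  obtains P where "\<And>t. t \<in> T \<Longrightarrow> path_from_to E A T (P t) \<and> distinct (P t) \<and> last (P t) = t"
    and "\<And>t u. t \<in> T \<Longrightarrow> u \<in> T \<Longrightarrow> t \<noteq> u \<Longrightarrow> set (P t) \<inter> set (P u) = {}"
proof -
  have b: "bij_betw last Ps T"
    by (rule linkage_endpoint_bij[OF assms(1) _ assms(2,3)]) (auto simp: path_from_to_def)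
  let ?P = "inv_into Ps last"
  have "?P t \<in> Ps" "last (?P t) = t" if "t \<in> T" for t
    using b that by (auto simp: bij_betw_def inv_into_into f_inv_into_f)
  then show ?thesis using that[of ?P] assms(1) unfolding linkage_def by metis
qed

lemma linkage_indexed_by_starts:
  assumes "linkage E T B Ps" "finite T" "card Ps = card T"
  obtains Q where "\<And>t. t \<in> T \<Longrightarrow> path_from_to E T B (Q t) \<and> distinct (Q t) \<and> hd (Q t) = t"
    and "\<And>t u. t \<in> T \<Longrightarrow> u \<in> T \<Longrightarrow> t \<noteq> u \<Longrightarrow> set (Q t) \<inter> set (Q u) = {}"
proof -
  have b: "bij_betw hd Ps T"
    by (rule linkage_endpoint_bij[OF assms(1) _ assms(2,3)]) (auto simp: path_from_to_def)
  let ?P = "inv_into Ps hd"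
  have "?P t \<in> Ps" "hd (?P t) = t" if "t \<in> T" for t
    using b that by (auto simp: bij_betw_def inv_into_into f_inv_into_f)
  then show ?thesis using that[of ?P] assms(1) unfolding linkage_def by metis
qed

text \<open>Using the edge \<open>(x, y)\<close> requires an \<open>x\<close> that is not the last
  vertex; an \<open>x\<close> at the very end does no harm, whence \<open>butlast\<close>.\<close>

lemma successively_insert_avoid_start:
  assumes "successively (\<lambda>u v. (u, v) \<in> insert (x, y) F) xs" "x \<notin> set (butlast xs)"
  shows "successively (\<lambda>u v. (u, v) \<in> F) xs"
  using assms by (induction xs rule: induct_list012) (auto split: if_splits)

lemma successively_insert_avoid_end:
  assumes "successively (\<lambda>u v. (u, v) \<in> insert (x, y) F) xs" "y \<notin> set (tl xs)"
  shows "successively (\<lambda>u v. (u, v) \<in> F) xs"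
  using assms by (induction xs rule: induct_list012) (auto split: if_splits)

text \<open>A walk that avoids one end of the new edge cannot use this edge, so it is a walk in
  \<open>F\<close>.\<close>

lemma separates_insert_edge:
  assumes "separates F A B S" "z = x \<or> z = y"
  shows "separates (insert (x, y) F) A B (insert z S)"
  unfolding separates_def
proof (intro allI impI notI)
  fix xs assume xs: "path_from_to (insert (x, y) F) A B xs" "set xs \<inter> insert z S = {}"
  have "x \<notin> set (butlast xs) \<or> y \<notin> set (tl xs)"
    using assms(2) xs(2) in_set_butlastD[of x xs] list.set_sel(2)[of xs y]
    by (cases "xs = []") auto
  moreover have "successively (\<lambda>u v. (u, v) \<in> insert (x, y) F) xs"
    using xs(1) unfolding path_from_to_def by (elim conjE)
  ultimately have "successively (\<lambda>u v. (u, v) \<in> F) xs"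
    using successively_insert_avoid_start[of x y F xs] successively_insert_avoid_end[of x y F xs]
    by satx
  then have "path_from_to F A B xs"
    using xs(1) unfolding path_from_to_def by simp
  with assms(1) xs(2) show False unfolding separates_def by blast
qed

text \<open>Every walk meets \<open>insert x S\<close>. Its part up to the first such vertex
  contains \<open>x\<close> at most at the end, hence does not use \<open>(x, y)\<close>. This part
  is a walk in \<open>F\<close> to \<open>insert x S\<close>, which \<open>T\<close> must
  meet.\<close>

lemma separates_insert_edge_start:
  assumes "separates F A B S" "separates F A (insert x S) T"
  shows "separates (insert (x, y) F) A B T"
  unfolding separates_def
proof (intro allI impI)
  fix xs assume xs: "path_from_to (insert (x, y) F) A B xs"
  then have "\<exists>z\<in>set xs. z \<in> insert x S"
    using separates_insert_edge[OF assms(1), of x x y] unfolding separates_def by blast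
  then obtain us z vs where split: "xs = us @ z # vs" "z \<in> insert x S" "\<forall>w\<in>set us. w \<notin> insert x S"
    using split_list_first_prop[of xs "\<lambda>z. z \<in> insert x S"] by blast
  have "successively (\<lambda>u v. (u, v) \<in> insert (x, y) F) (us @ [z])"
    using xs unfolding path_from_to_def split(1) by (auto simp: successively_append_iff)
  then have "successively (\<lambda>u v. (u, v) \<in> F) (us @ [z])"
    by (rule successively_insert_avoid_start) (use split(3) in auto)
  then have "path_from_to F A (insert x S) (us @ [z])"
    using xs split(1,2) unfolding path_from_to_def by (cases us) auto
  then show "set xs \<inter> T \<noteq> {}" using assms(2) split(1) unfolding separates_def by fastforce
qed

text \<open>The mirror image: from the last vertex in \<open>insert y S\<close> on, \<open>y\<close>
  occurs at most at the start.\<close>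

lemma separates_insert_edge_end:
  assumes "separates F A B S" "separates F (insert y S) B T"
  shows "separates (insert (x, y) F) A B T"
  unfolding separates_def
proof (intro allI impI)
  fix xs assume xs: "path_from_to (insert (x, y) F) A B xs"
  then have "\<exists>z\<in>set xs. z \<in> insert y S"
    using separates_insert_edge[OF assms(1), of y x y] unfolding separates_def by blast
  then obtain us z vs where split: "xs = us @ z # vs" "z \<in> insert y S" "\<forall>w\<in>set vs. w \<notin> insert y S"
    using split_list_last_prop[of xs "\<lambda>z. z \<in> insert y S"] by blast
  have "successively (\<lambda>u v. (u, v) \<in> insert (x, y) F) (z # vs)"
    using xs unfolding path_from_to_def split(1) by (auto simp: successively_append_iff)
  then have "successively (\<lambda>u v. (u, v) \<in> F) (z # vs)"
    by (rule successively_insert_avoid_end) (use split(3) in auto)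
  then have "path_from_to F (insert y S) B (z # vs)"
    using xs split(1,2) unfolding path_from_to_def by auto
  then show "set xs \<inter> T \<noteq> {}" using assms(2) split(1) unfolding separates_def by fastforce
qed

text \<open>Following \<open>p\<close> up to \<open>z\<close> and then \<open>q\<close> gives a walk
  from \<open>A\<close> to \<open>B\<close>, which must meet \<open>S\<close>. Before
  \<open>z\<close> there is no vertex of \<open>S\<close>, as \<open>p\<close> can have one only at
  its end; after \<open>z\<close> there is none, as \<open>q\<close> can have one only at its start.
  So \<open>z\<close> itself lies in \<open>S\<close>.\<close>

lemma paths_meet_only_at_separator:
  assumes sep: "separates F A B S"
    and P: "path_from_to F A X p" "distinct p" "set p \<inter> S \<subseteq> {last p}"
    and Q: "path_from_to F Y B q" "distinct q" "set q \<inter> S \<subseteq> {hd q}"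
    and z: "z \<in> set p" "z \<in> set q"
  shows "last p = z \<and> z \<in> S \<or> hd q = z \<and> z \<in> S"
proof -
  obtain p1 p2 where p: "p = p1 @ z # p2" using z(1) by (meson split_list)
  obtain q1 q2 where q: "q = q1 @ z # q2" using z(2) by (meson split_list)
  have "successively (\<lambda>u v. (u, v) \<in> F) (p1 @ [z])" "successively (\<lambda>u v. (u, v) \<in> F) (z # q2)"
    using P(1) Q(1) unfolding path_from_to_def p q by (auto simp: successively_append_iff)
  then have "successively (\<lambda>u v. (u, v) \<in> F) (p1 @ z # q2)"
    by (simp add: successively_append_iff successively_Cons)
  moreover have "hd (p1 @ z # q2) \<in> A"
    using P(1) unfolding path_from_to_def p by (auto simp: hd_append split: if_splits)
  moreover have "last (p1 @ z # q2) \<in> B"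
    using Q(1) unfolding path_from_to_def q by simp
  ultimately have "path_from_to F A B (p1 @ z # q2)"
    unfolding path_from_to_def by simp
  then have "set (p1 @ z # q2) \<inter> S \<noteq> {}"
    using sep unfolding separates_def by (elim allE impE)
  then obtain w where w: "w \<in> S" "w \<in> set p1 \<or> w = z \<or> w \<in> set q2"
    by auto
  have "w \<notin> set p1"
  proof
    assume w1: "w \<in> set p1"
    then have "w \<in> set p" unfolding p by simp
    then have "w = last p" using P(3) w(1) by blast
    then have "w \<in> set (z # p2)" unfolding p by simp
    then show False using P(2) w1 unfolding p by auto
  qed
  moreover have "w \<notin> set q2"
  proof
    assume w2: "w \<in> set q2"
    then have "w \<in> set q" unfolding q by simp
    then have "w = hd q" using Q(3) w(1) by blast
    then have "w \<in> set (q1 @ [z])" unfolding q by (cases q1) auto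
    then show False using Q(2) w2 unfolding q by auto
  qed
  ultimately have "w = z" using w(2) by blast
  then have "z \<in> S" using w(1) by simp
  then show ?thesis using P(3) z(1) by blast
qed

text \<open>
  Goering's proof: if deleting the edge \<open>(x, y)\<close> leaves a separator \<open>S\<close> with fewer than \<open>k\<close> vertices,
  linkages from \<open>A\<close> to \<open>S \<union> {x}\<close> and from \<open>S \<union> {y}\<close> to \<open>B\<close> are glued along \<open>S\<close> and \<open>(x, y)\<close>.
\<close>

theorem menger:
  assumes "finite E" "finite A" "finite B"
    and "\<And>S. finite S \<Longrightarrow> separates E A B S \<Longrightarrow> k \<le> card S"
  shows "\<exists>Ps. linkage E A B Ps \<and> card Ps = k"
  using assms
proof (induction E arbitrary: A B k rule: finite_induct)
  case empty
  have "separates {} A B (A \<inter> B)"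
    unfolding separates_def path_from_to_def
  proof (intro allI impI)
    fix xs :: "'a list"
    assume "xs \<noteq> [] \<and> successively (\<lambda>u v. (u, v) \<in> {}) xs \<and> hd xs \<in> A \<and> last xs \<in> B"
    then show "set xs \<inter> (A \<inter> B) \<noteq> {}"
      by (cases xs rule: remdups_adj.cases) auto
  qed
  then have "k \<le> card (A \<inter> B)" using empty by blast
  then obtain X where X: "X \<subseteq> A \<inter> B" "card X = k" by (meson obtain_subset_with_card_n)
  show ?case
    using linkage_of_disjoint_paths[of X "{}" A B "\<lambda>x. [x]"] X by (auto simp: path_from_to_def)
next
  case (insert e F)
  obtain x y where e: "e = (x, y)" by fastforce
  let ?E = "insert (x, y) F"
  have min: "k \<le> card T" if "finite T" "separates ?E A B T" for T
    using insert.prems(3)[of T] that e by simp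
  show ?case
  proof (cases "\<forall>S. finite S \<longrightarrow> separates F A B S \<longrightarrow> k \<le> card S")
    case True
    then obtain Ps where "linkage F A B Ps" "card Ps = k"
      using insert.IH[of A B k] insert.prems by blast
    then show ?thesis using linkage_mono by blast
  next
    case False
    then obtain S where S: "finite S" "separates F A B S" "card S < k" by force
    \<comment> \<open>Both sets separate in the larger graph, so they have at least \<open>k\<close>
      elements, whereas \<open>S\<close> has fewer. Hence neither end of the edge lies in
      \<open>S\<close>, and \<open>S\<close> has exactly \<open>k - 1\<close> elements.\<close>
    have "k \<le> card (insert x S)" "k \<le> card (insert y S)"
      using min separates_insert_edge[OF S(2)] S(1) by blast+
    then have xS: "x \<notin> S" and yS: "y \<notin> S" and cx: "card (insert x S) = k" and cy: "card (insert y S) = k"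
      using S(1,3) by (auto simp: card_insert_if split: if_splits)
    have "\<exists>Ps. linkage F A (insert x S) Ps \<and> card Ps = k"
      using insert.IH[of A "insert x S" k] insert.prems(1) S(1) min
        separates_insert_edge_start[OF S(2)] by blast
    then obtain P where P: "\<And>t. t \<in> insert x S \<Longrightarrow>
          path_from_to F A (insert x S) (P t) \<and> distinct (P t) \<and> last (P t) = t"
      and Pd: "\<And>t u. t \<in> insert x S \<Longrightarrow> u \<in> insert x S \<Longrightarrow> t \<noteq> u \<Longrightarrow> set (P t) \<inter> set (P u) = {}"
      using linkage_indexed_by_ends[of F A "insert x S"] S(1) cx by (metis finite_insert)
    have "\<exists>Ps. linkage F (insert y S) B Ps \<and> card Ps = k"
      using insert.IH[of "insert y S" B k] insert.prems(2) S(1) min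
        separates_insert_edge_end[OF S(2)] by blast
    then obtain Q where Q: "\<And>t. t \<in> insert y S \<Longrightarrow>
          path_from_to F (insert y S) B (Q t) \<and> distinct (Q t) \<and> hd (Q t) = t"
      and Qd: "\<And>t u. t \<in> insert y S \<Longrightarrow> u \<in> insert y S \<Longrightarrow> t \<noteq> u \<Longrightarrow> set (Q t) \<inter> set (Q u) = {}"
      using linkage_indexed_by_starts[of F "insert y S" B] S(1) cy by (metis finite_insert)
    have Pm: "t \<in> set (P t)" if "t \<in> insert x S" for t
      using P[OF that] unfolding path_from_to_def by (metis last_in_set)
    have Qm: "t \<in> set (Q t)" if "t \<in> insert y S" for t
      using Q[OF that] unfolding path_from_to_def by (metis hd_in_set)
    have PS: "set (P t) \<inter> S \<subseteq> {t}" if "t \<in> insert x S" for t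
      using Pd[OF that] Pm by blast
    have QS: "set (Q t) \<inter> S \<subseteq> {t}" if "t \<in> insert y S" for t
      using Qd[OF that] Qm by blast
    \<comment> \<open>A common vertex lies in \<open>S\<close>, and each of the two paths can meet
      \<open>S\<close> only in its own index.\<close>
    have PQ: "set (P s) \<inter> set (Q t) = {}"
      if st: "s \<in> insert x S" "t \<in> insert y S" "s \<noteq> t" for s t
    proof (rule ccontr)
      assume "set (P s) \<inter> set (Q t) \<noteq> {}"
      then obtain z where z: "z \<in> set (P s)" "z \<in> set (Q t)" by blast
      have "s = z \<and> z \<in> S \<or> t = z \<and> z \<in> S"
        using paths_meet_only_at_separator[OF S(2), of "insert x S" "P s" "insert y S" "Q t" z]
          P[OF st(1)] Q[OF st(2)] PS[OF st(1)] QS[OF st(2)] z by auto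
      then show False using PS[OF st(1)] QS[OF st(2)] z st(3) by blast
    qed
    \<comment> \<open>For \<open>s\<close> in \<open>S\<close> the two paths share the vertex
      \<open>s\<close>, which \<open>tl\<close> keeps from being listed twice. The remaining paths,
      indexed by \<open>x\<close> and \<open>y\<close>, are joined by the edge
      \<open>(x, y)\<close>.\<close>
    define R where "R s = (if s = x then P x @ Q y else P s @ tl (Q s))" for s
    have setR: "set (R s) \<subseteq> set (P s) \<union> set (Q s)" if "s \<in> S" for s
      using that xS unfolding R_def by (cases "Q s") auto
    have Rx: "set (R x) = set (P x) \<union> set (Q y)" by (simp add: R_def)
    have "path_from_to ?E A B (R s)" if s: "s \<in> insert x S" for s
    proof (cases "s = x")
      case True
      have "successively (\<lambda>u v. (u, v) \<in> ?E) (P x)" "successively (\<lambda>u v. (u, v) \<in> ?E) (Q y)"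
        using P[of x] Q[of y] successively_rel_mono[of F _ ?E] unfolding path_from_to_def by blast+
      then show ?thesis using P[of x] Q[of y] True
        unfolding path_from_to_def R_def by (auto simp: successively_append_iff)
    next
      case False
      then have "s \<in> S" using s by simp
      then have *: "path_from_to F A (insert x S) (P s)" "path_from_to F (insert y S) B (Q s)"
        "last (P s) = s" "hd (Q s) = s"
        using P[of s] Q[of s] by auto
      then obtain q where q: "Q s = s # q" unfolding path_from_to_def by (metis list.collapse)
      have "successively (\<lambda>u v. (u, v) \<in> F) (P s @ q)"
        using * unfolding path_from_to_def q by (auto simp: successively_append_iff successively_Cons)
      then have "successively (\<lambda>u v. (u, v) \<in> ?E) (P s @ q)"
        by (rule successively_mono) auto
      then show ?thesis using * False unfolding path_from_to_def R_def q
        by (auto split: if_splits)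
    qed
    moreover have "set (R s) \<inter> set (R t) = {}"
      if st: "s \<in> insert x S" "t \<in> insert x S" "s \<noteq> t" for s t
    proof -
      have *: "set (R s) \<inter> set (R x) = {}" if "s \<in> S" for s
        using setR[OF that] Rx Pd[of s x] Qd[of s y] PQ[of s y] PQ[of x s] that xS yS by blast
      have **: "set (R s) \<inter> set (R t) = {}" if "s \<in> S" "t \<in> S" "s \<noteq> t"
        using setR[of s] setR[of t] Pd[of s t] Qd[of s t] PQ[of s t] PQ[of t s] that by blast
      show ?thesis using * ** st by blast
    qed
    ultimately show ?thesis
      using linkage_of_disjoint_paths[of "insert x S" ?E A B R] cx e by auto
  qed
qed

section \<open>Disjoint paths in graphs without small separations\<close>

text \<open>For a symmetric \<open>E\<close>, such as \<open>adj \<Gamma>\<close>, the last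
  condition excludes edges in both directions.\<close>

definition separation :: "'v rel \<Rightarrow> 'v set \<Rightarrow> 'v set \<Rightarrow> 'v set \<Rightarrow> 'v set \<Rightarrow> bool" where
  "separation E V A S B \<longleftrightarrow> A \<union> S \<union> B = V \<and> A \<inter> S = {} \<and> A \<inter> B = {} \<and> S \<inter> B = {} \<and>
     A \<noteq> {} \<and> B \<noteq> {} \<and> E \<inter> A \<times> B = {}"

lemma path_from_to_subset:
  assumes "path_from_to E A B xs" "E \<subseteq> W \<times> W" "A \<subseteq> W"
  shows "set xs \<subseteq> W"
proof -
  have "successively (\<lambda>u v. (u, v) \<in> E) xs \<Longrightarrow> hd xs \<in> W \<Longrightarrow> set xs \<subseteq> W"
    using assms(2) by (induction xs rule: induct_list012) auto
  then show ?thesis using assms(1,3) unfolding path_from_to_def by blast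
qed

text \<open>Let \<open>X\<close> be what can be reached from \<open>a\<close> within
  \<open>W\<close> while avoiding \<open>S\<close>, together with \<open>a\<close>, and
  \<open>Y\<close> the rest outside \<open>S\<close>. Only the edge \<open>(a, b)\<close> can lead
  from \<open>X\<close> to \<open>Y\<close>. Without it there is a separation by vertices of
  \<open>S\<close>; with it, moving \<open>a\<close> or \<open>b\<close> into the separator costs
  one vertex.\<close>

lemma separator_of_neighbours_large:
  fixes E :: "'v rel"
  assumes fin: "finite V" and EV: "E \<subseteq> V \<times> V" and irr: "\<And>v. (v, v) \<notin> E"
    and size: "n < card V"
    and nosep: "\<And>A S B. separation E V A S B \<Longrightarrow> n \<le> card S"
    and ab: "a \<in> V" "b \<in> V" "a \<noteq> b"
    and W: "W = V - {a, b}"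
    and sep: "separates (E \<inter> W \<times> W) {v \<in> W. (a, v) \<in> E} {v \<in> W. (v, b) \<in> E} S"
    and S: "finite S"
  shows "(if (a, b) \<in> E then n - 1 else n) \<le> card S"
proof -
  let ?R = "E \<inter> W \<times> W" and ?A = "{v \<in> W. (a, v) \<in> E}" and ?B = "{v \<in> W. (v, b) \<in> E}"
  define T where "T = S \<inter> W"
  define X where "X = insert a {v. \<exists>xs. path_from_to ?R ?A {v} xs \<and> set xs \<inter> S = {}}"
  define Y where "Y = V - T - X"
  have T: "finite T" "card T \<le> card S" "a \<notin> T" "b \<notin> T" "T \<subseteq> V"
    using S by (auto simp: T_def W intro: card_mono)
  have walkW: "set xs \<subseteq> W" if "path_from_to ?R ?A C xs" for C xs
    using path_from_to_subset[OF that] by blast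
  have walk_end: "v \<in> set xs" if "path_from_to ?R ?A {v} xs" for v xs
    using that unfolding path_from_to_def by (metis last_in_set singletonD)
  have XW: "v \<in> W - S" if "v \<in> X" "v \<noteq> a" for v
    using that walkW walk_end unfolding X_def by blast
  have aX: "a \<in> X" by (simp add: X_def)
  have bY: "b \<in> Y" using XW[of b] ab T unfolding Y_def W by auto
  have XV: "X \<subseteq> V" using XW ab unfolding W by blast
  have XT: "X \<inter> T = {}" using XW T(3) unfolding T_def by blast
  \<comment> \<open>Any other edge would prolong a walk avoiding \<open>S\<close>, which puts
    \<open>v\<close> into \<open>X\<close>, or, if \<open>v = b\<close>, would reveal such a walk
    between the two neighbourhoods.\<close>
  have cross: "u = a \<and> v = b" if uv: "(u, v) \<in> E" "u \<in> X" "v \<in> Y" for u v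
  proof (rule ccontr)
    assume not: "\<not> (u = a \<and> v = b)"
    have v: "v \<noteq> a" "v \<notin> X" "v \<in> V" "v \<notin> T" using uv(3) aX unfolding Y_def by auto
    show False
    proof (cases "u = a")
      case True
      then have "v \<in> ?A" "v \<notin> S" using v uv not by (auto simp: W T_def)
      then have "path_from_to ?R ?A {v} [v]" "set [v] \<inter> S = {}" unfolding path_from_to_def by auto
      then show False using v(2) unfolding X_def by blast
    next
      case False
      then obtain xs where xs: "path_from_to ?R ?A {u} xs" "set xs \<inter> S = {}"
        using uv(2) unfolding X_def by blast
      have u: "u \<in> W" using XW uv(2) False by blast
      show False
      proof (cases "v = b")
        case True
        then have "path_from_to ?R ?A ?B xs"
          using xs(1) u uv(1) unfolding path_from_to_def by auto
        then show False using sep xs(2) unfolding separates_def by blast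
      next
        case vb: False
        then have vW: "v \<in> W" "v \<notin> S" using v by (auto simp: W T_def)
        then have "path_from_to ?R ?A {v} (xs @ [v])"
          using xs(1) u uv(1) unfolding path_from_to_def by (auto simp: successively_append_iff)
        moreover have "set (xs @ [v]) \<inter> S = {}" using xs(2) vW by auto
        ultimately show False using v(2) unfolding X_def by blast
      qed
    qed
  qed
  have part: "X \<union> T \<union> Y = V" "X \<inter> Y = {}" "T \<inter> Y = {}"
    using XV T unfolding Y_def by auto
  show ?thesis
  proof (cases "(a, b) \<in> E")
    case False
    then have "separation E V X T Y"
      unfolding separation_def using part XT aX bY cross by blast
    then show ?thesis using nosep T False by fastforce
  next
    case True
    have finXY: "finite X" "finite Y" using fin XV part(1) by (auto intro: finite_subset)
    have cV: "card V = card X + card T + card Y"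
      using part XT finXY T(1) by (metis Int_Un_distrib2 card_Un_disjoint finite_Un sup_bot.right_neutral)
    show ?thesis
    proof (rule ccontr)
      assume "\<not> ?thesis"
      then have less: "card T + 1 < n" using True T(2) by simp
      \<comment> \<open>If the separator is too small, \<open>size\<close> leaves at least three
        vertices outside \<open>T\<close>, so one side stays nonempty after giving up
        \<open>a\<close> or \<open>b\<close>.\<close>
      then have "card X + card Y \<ge> 3" using cV size by linarith
      then consider "card X \<ge> 2" | "card Y \<ge> 2" by linarith
      then show False
      proof cases
        case 1
        then have "X - {a} \<noteq> {}"
          using card_mono[of "{a}" X] by fastforce
        then have "separation E V (X - {a}) (insert a T) Y"
          unfolding separation_def using part XT aX bY cross by blast
        then show False using nosep[of "X - {a}" "insert a T" Y] less card_insert_le_m1 T(1,3) by auto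
      next
        case 2
        then have "Y - {b} \<noteq> {}"
          using card_mono[of "{b}" Y] by fastforce
        then have "separation E V X (insert b T) (Y - {b})"
          unfolding separation_def using part XT aX bY cross by blast
        then show False using nosep[of X "insert b T" "Y - {b}"] less T(1,4) by auto
      qed
    qed
  qed
qed

text \<open>Menger's theorem is applied inside \<open>W\<close> to the neighbourhoods of
  \<open>a\<close> and \<open>b\<close>. It yields \<open>n\<close> paths, or \<open>n - 1\<close>
  if \<open>(a, b)\<close> is an edge, which then is the missing path.\<close>

lemma disjoint_paths_if_no_separation:
  fixes E :: "'v rel"
  assumes fin: "finite V" and EV: "E \<subseteq> V \<times> V" and irr: "\<And>v. (v, v) \<notin> E"
    and size: "n < card V"
    and nosep: "\<And>A S B. separation E V A S B \<Longrightarrow> n \<le> card S"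
    and ab: "a \<in> V" "b \<in> V" "a \<noteq> b"
  obtains Ls where "finite Ls" "card Ls = n"
    "\<forall>xs\<in>Ls. path_from_to E {a} {b} xs \<and> distinct xs \<and> set xs \<subseteq> V"
    "\<forall>xs\<in>Ls. \<forall>ys\<in>Ls. xs \<noteq> ys \<longrightarrow> set xs \<inter> set ys = {a, b}"
\<comment> \<open>Below, \<open>n - 1\<close> paths and the edge \<open>(a, b)\<close> add up to
  \<open>n\<close> only for positive \<open>n\<close>.\<close>
proof (cases "n = 0")
  case True
  then show ?thesis using that[of "{}"] by simp
next
  case False
  define W where "W = V - {a, b}"
  define m where "m = (if (a, b) \<in> E then n - 1 else n)"
  let ?R = "E \<inter> W \<times> W" and ?A = "{v \<in> W. (a, v) \<in> E}" and ?B = "{v \<in> W. (v, b) \<in> E}"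
  have finR: "finite ?R" "finite ?A" "finite ?B"
    using fin by (auto simp: W_def)
  have "m \<le> card S" if "finite S" "separates ?R ?A ?B S" for S
    unfolding m_def by (rule separator_of_neighbours_large[OF fin EV irr size nosep ab W_def that(2,1)])
  then obtain Ps where Ps: "linkage ?R ?A ?B Ps" "card Ps = m"
    using menger[OF finR] by blast
  \<comment> \<open>For \<open>m = 0\<close> the equation \<open>card Ps = m\<close> would also hold
    for an infinite \<open>Ps\<close>; the subfamily is finite in any case.\<close>
  then obtain Qs where Qs: "Qs \<subseteq> Ps" "card Qs = m" "finite Qs"
    by (metis obtain_subset_with_card_n order_refl)
  have Q: "path_from_to ?R ?A ?B p" "distinct p" if "p \<in> Qs" for p
    using that Qs Ps unfolding linkage_def by blast+
  have QW: "set p \<subseteq> W" if "p \<in> Qs" for p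
    using path_from_to_subset[OF Q(1)[OF that]] by blast
  have Qd: "set p \<inter> set q = {}" if "p \<in> Qs" "q \<in> Qs" "p \<noteq> q" for p q
    using that Qs Ps unfolding linkage_def by blast
  define f where "f p = a # p @ [b]" for p
  have fpath: "path_from_to E {a} {b} (f p) \<and> distinct (f p) \<and> set (f p) \<subseteq> V" if "p \<in> Qs" for p
  proof -
    have "successively (\<lambda>u v. (u, v) \<in> E) p"
      by (rule successively_rel_mono[of ?R]) (use Q(1)[OF that] in \<open>auto simp: path_from_to_def\<close>)
    then have "path_from_to E {a} {b} (f p)"
      using Q(1)[OF that] unfolding path_from_to_def f_def
      by (auto simp: successively_append_iff successively_Cons hd_append)
    moreover have "distinct (f p)" "set (f p) \<subseteq> V"
      using Q(2)[OF that] QW[OF that] ab unfolding f_def W_def by auto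
    ultimately show ?thesis by blast
  qed
  have fdisj: "set (f p) \<inter> set (f q) = {a, b}" if "p \<in> Qs" "q \<in> Qs" "p \<noteq> q" for p q
    using Qd[OF that] QW[OF that(1)] QW[OF that(2)] unfolding f_def W_def by auto
  define Ls where "Ls = f ` Qs"
  have "inj_on f Qs" by (auto simp: inj_on_def f_def)
  then have cL: "card Ls = m" "finite Ls" using Qs by (auto simp: card_image Ls_def)
  have L: "path_from_to E {a} {b} xs \<and> distinct xs \<and> set xs \<subseteq> V \<and> {a, b} \<subseteq> set xs" if "xs \<in> Ls" for xs
  proof -
    obtain p where p: "p \<in> Qs" "xs = f p" using \<open>xs \<in> Ls\<close> unfolding Ls_def by blast
    then show ?thesis using fpath[OF p(1)] by (simp add: f_def)
  qed
  have Ld: "set xs \<inter> set ys = {a, b}" if "xs \<in> Ls" "ys \<in> Ls" "xs \<noteq> ys" for xs ys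
    using that fdisj unfolding Ls_def by (metis imageE)
  show ?thesis
  proof (cases "(a, b) \<in> E")
    case False
    then have "card Ls = n" using cL by (simp add: m_def)
    then show ?thesis using that[of Ls] cL(2) L Ld by simp
  next
    case True
    have "p \<noteq> []" if "p \<in> Qs" for p using Q(1)[OF that] by (simp add: path_from_to_def)
    then have "[a, b] \<notin> Ls" by (auto simp: f_def Ls_def)
    then have "card (insert [a, b] Ls) = n"
      using cL True \<open>n \<noteq> 0\<close> by (simp add: m_def)
    moreover have "path_from_to E {a} {b} [a, b]" using True by (simp add: path_from_to_def)
    moreover have "set [a, b] \<inter> set xs = {a, b}" "set xs \<inter> set [a, b] = {a, b}" if "xs \<in> Ls" for xs
      using L[OF that] by auto
    moreover have "distinct [a, b]" "set [a, b] \<subseteq> V" using ab by auto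
    moreover have "finite (insert [a, b] Ls)" using cL(2) by simp
    ultimately show ?thesis
      using that[of "insert [a, b] Ls"] L Ld by simp
  qed
qed

section \<open>From vertex lists to path subgraphs\<close>

definition adj :: "('v, 'e) mgraph \<Rightarrow> 'v rel" where
  "adj \<Gamma> = {(u, v). \<exists>e\<in>edges \<Gamma>. ends \<Gamma> e = {u, v}}"

text \<open>One edge is chosen for each pair of consecutive vertices. The last clause remembers
  this, since disjointness of paths also concerns edges.\<close>

lemma path_graph_exists:
  assumes "path_from_to (adj \<Gamma>) {a} {b} xs" "distinct xs" "set xs \<subseteq> verts \<Gamma>"
  shows "\<exists>P. path_between \<Gamma> a b P \<and> verts P = set xs \<and> ends P = ends \<Gamma> \<and>
      (\<forall>e\<in>edges P. \<exists>i. Suc i < length xs \<and> ends \<Gamma> e = {xs ! i, xs ! Suc i})"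
proof -
  have "(xs ! i, xs ! Suc i) \<in> adj \<Gamma>" if "Suc i < length xs" for i
    using assms(1) that unfolding path_from_to_def successively_conv_nth by blast
  then have "\<forall>i. \<exists>e. Suc i < length xs \<longrightarrow> e \<in> edges \<Gamma> \<and> ends \<Gamma> e = {xs ! i, xs ! Suc i}"
    unfolding adj_def by blast
  then obtain ed where ed: "\<And>i. Suc i < length xs \<Longrightarrow> ed i \<in> edges \<Gamma> \<and> ends \<Gamma> (ed i) = {xs ! i, xs ! Suc i}"
    by metis
  define es where "es = map ed [0..<length xs - 1]"
  define P where "P = \<lparr>verts = set xs, edges = set es, ends = ends \<Gamma>\<rparr>"
  have len: "length xs = Suc (length es)"
    using assms(1) by (cases xs) (auto simp: es_def path_from_to_def)
  have es: "e \<in> edges \<Gamma> \<and> (\<exists>i. Suc i < length xs \<and> ends \<Gamma> e = {xs ! i, xs ! Suc i})"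
    if "e \<in> set es" for e
  proof -
    obtain i where i: "i < length xs - 1" "e = ed i" using \<open>e \<in> set es\<close> unfolding es_def by auto
    then have "Suc i < length xs" by linarith
    then show ?thesis using ed i(2) by blast
  qed
  have "subgraph P \<Gamma>"
    unfolding subgraph_def P_def using assms(3) es by (fastforce)
  moreover have "\<forall>i<length es. ends \<Gamma> (es ! i) = {xs ! i, xs ! Suc i}"
    using ed len unfolding es_def by auto
  ultimately have "path_between \<Gamma> a b P"
    unfolding path_between_def using len assms(1,2)
    by (intro conjI exI[of _ xs] exI[of _ es]) (auto simp: path_from_to_def P_def)
  then show ?thesis using es by (intro exI[of _ P]) (auto simp: P_def)
qed

text \<open>Without repetitions, the positions \<open>i\<close> and \<open>Suc i\<close> must be the
  first and the last one. This settles when two paths with only their endpoints in common can share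
  an edge.\<close>

lemma distinct_length_2:
  assumes "distinct xs" "Suc i < length xs" "{xs ! i, xs ! Suc i} \<subseteq> {hd xs, last xs}"
  shows "xs = [hd xs, last xs]"
proof -
  have ne: "xs \<noteq> []" using assms(2) by auto
  have "xs ! i = xs ! 0 \<or> xs ! i = xs ! (length xs - 1)"
    "xs ! Suc i = xs ! 0 \<or> xs ! Suc i = xs ! (length xs - 1)"
    using assms(3) ne by (auto simp: hd_conv_nth last_conv_nth)
  moreover have "xs ! j = xs ! k \<longleftrightarrow> j = k" if "j < length xs" "k < length xs" for j k
    using nth_eq_iff_index_eq[OF assms(1) that] .
  ultimately have "i = 0 \<or> i = length xs - 1" "Suc i = 0 \<or> Suc i = length xs - 1"
    using assms(2) by (metis Suc_lessD diff_less length_greater_0_conv less_one ne)+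
  then have "length xs = 2" using assms(2) by auto
  then show ?thesis by (auto simp: numeral_2_eq_2 length_Suc_conv)
qed

lemma d_connected_if_no_separation:
  assumes graph: "multigraph \<Gamma>"
    and size: "n < card (verts \<Gamma>)"
    and nosep: "\<And>A S B. separation (adj \<Gamma>) (verts \<Gamma>) A S B \<Longrightarrow> n \<le> card S"
  shows "d_connected n \<Gamma>"
  unfolding d_connected_def
proof (intro ballI impI)
  fix a b assume ab: "a \<in> verts \<Gamma>" "b \<in> verts \<Gamma>" "a \<noteq> b"
  have V: "finite (verts \<Gamma>)" "adj \<Gamma> \<subseteq> verts \<Gamma> \<times> verts \<Gamma>" "\<And>v. (v, v) \<notin> adj \<Gamma>"
    using graph unfolding multigraph_def adj_def by force+
  obtain Ls where Ls: "finite Ls" "card Ls = n"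
    and Lp: "\<forall>xs\<in>Ls. path_from_to (adj \<Gamma>) {a} {b} xs \<and> distinct xs \<and> set xs \<subseteq> verts \<Gamma>"
    and Ld: "\<forall>xs\<in>Ls. \<forall>ys\<in>Ls. xs \<noteq> ys \<longrightarrow> set xs \<inter> set ys = {a, b}"
    by (rule disjoint_paths_if_no_separation[OF V size nosep ab])
  have "\<exists>P. path_between \<Gamma> a b P \<and> verts P = set xs \<and> ends P = ends \<Gamma> \<and>
      (\<forall>e\<in>edges P. \<exists>i. Suc i < length xs \<and> ends \<Gamma> e = {xs ! i, xs ! Suc i})" if "xs \<in> Ls" for xs
    using path_graph_exists[of \<Gamma> a b xs] bspec[OF Lp that] by simp
  then obtain p where p: "\<And>xs. xs \<in> Ls \<Longrightarrow> path_between \<Gamma> a b (p xs) \<and> verts (p xs) = set xs \<and>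
      ends (p xs) = ends \<Gamma> \<and>
      (\<forall>e\<in>edges (p xs). \<exists>i. Suc i < length xs \<and> ends \<Gamma> e = {xs ! i, xs ! Suc i})"
    by metis
  have dis: "disjoint_paths a b (p xs) (p ys)" if xy: "xs \<in> Ls" "ys \<in> Ls" "xs \<noteq> ys" for xs ys
  proof -
    \<comment> \<open>A common edge has both ends among the common vertices \<open>a\<close> and
      \<open>b\<close>; then both lists are \<open>[a, b]\<close>, contrary to
      \<open>xs \<noteq> ys\<close>.\<close>
    have direct: "zs = [a, b]" if zs: "zs \<in> Ls" "e \<in> edges (p zs)" "ends \<Gamma> e \<subseteq> {a, b}" for zs e
    proof -
      obtain i where "Suc i < length zs" "ends \<Gamma> e = {zs ! i, zs ! Suc i}"
        using p[OF zs(1)] zs(2) by blast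
      moreover have "hd zs = a" "last zs = b" "distinct zs"
        using bspec[OF Lp zs(1)] by (auto simp: path_from_to_def)
      ultimately show ?thesis using distinct_length_2[of zs i] zs(3) by simp
    qed
    have sub: "ends \<Gamma> e \<subseteq> set zs" if "zs \<in> Ls" "e \<in> edges (p zs)" for zs e
      using p[OF that(1)] that(2) by fastforce
    have "edges (p xs) \<inter> edges (p ys) = {}"
    proof (rule ccontr)
      assume "edges (p xs) \<inter> edges (p ys) \<noteq> {}"
      then obtain e where e: "e \<in> edges (p xs)" "e \<in> edges (p ys)" by blast
      then have "ends \<Gamma> e \<subseteq> {a, b}"
        using sub[OF xy(1) e(1)] sub[OF xy(2) e(2)] Ld xy by blast
      then show False using direct xy e by metis
    qed
    then show ?thesis
      using p[OF xy(1)] p[OF xy(2)] Ld xy by (simp add: disjoint_paths_def graph_inter_def)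
  qed
  obtain h where h: "bij_betw h {..<n} Ls"
    using ex_bij_betw_nat_finite[OF Ls(1)] Ls(2) by (auto simp: atLeast0LessThan)
  show "\<exists>P. (\<forall>i<n. path_between \<Gamma> a b (P i)) \<and>
          (\<forall>i<n. \<forall>j<n. i \<noteq> j \<longrightarrow> disjoint_paths a b (P i) (P j))"
  proof (intro exI[of _ "p \<circ> h"] conjI allI impI)
    fix i assume "i < n"
    then show "path_between \<Gamma> a b ((p \<circ> h) i)" using p h by (auto simp: bij_betw_def)
  next
    fix i j assume "i < n" "j < n" "i \<noteq> j"
    then show "disjoint_paths a b ((p \<circ> h) i) ((p \<circ> h) j)"
      using dis[of "h i" "h j"] h by (auto simp: bij_betw_def inj_on_def)
  qed
qed

section \<open>Basic properties of separations\<close>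

lemma separation_sym: "sym E \<Longrightarrow> separation E V A S B \<Longrightarrow> separation E V B S A"
  unfolding separation_def sym_def by blast

lemma sym_adj: "sym (adj \<Gamma>)"
  by (auto simp: adj_def sym_def insert_commute)

text \<open>Otherwise \<open>s\<close> could be moved from \<open>S\<close> to \<open>A\<close>,
  leaving a smaller separator.\<close>

lemma minimal_separation_neighbour:
  assumes sep: "separation E V A S B" and "finite V"
    and min: "\<And>A' S' B'. separation E V A' S' B' \<Longrightarrow> card S \<le> card S'"
    and s: "s \<in> S"
  shows "\<exists>b\<in>B. (s, b) \<in> E"
proof (rule ccontr)
  assume "\<not> ?thesis"
  then have "separation E V (insert s A) (S - {s}) B"
    using sep s unfolding separation_def by blast
  moreover have "finite S" using sep \<open>finite V\<close> unfolding separation_def by (metis finite_Un)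
  ultimately show False using min[of "insert s A" "S - {s}" B] s card_Diff1_less[of S s] by simp
qed

text \<open>With \<open>S\<close> empty no edge leaves \<open>A\<close>, so by connectedness
  \<open>A\<close> would contain a vertex of \<open>B\<close>.\<close>

lemma separator_nonempty:
  assumes graph: "multigraph \<Gamma>" and conn: "connected_graph \<Gamma>"
    and sep: "separation (adj \<Gamma>) (verts \<Gamma>) A S B"
  shows "S \<noteq> {}"
proof
  assume S: "S = {}"
  obtain a b where ab: "a \<in> A" "b \<in> B" using sep by (auto simp: separation_def)
  have "(a, b) \<in> (adj \<Gamma>)\<^sup>*"
    using sep conn ab unfolding connected_graph_def separation_def adj_def by blast
  then have "b \<in> A"
  proof (induction rule: rtrancl_induct)
    case base
    then show ?case by (rule ab)
  next
    case (step y z)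
    have "z \<in> A \<union> B"
      using step(2) sep S graph unfolding separation_def multigraph_def adj_def by fastforce
    then show ?case using step(2,3) sep unfolding separation_def by blast
  qed
  then show False using ab sep by (auto simp: separation_def)
qed

section \<open>Planes over the two-element field\<close>

lemma fun_bit_add_self [simp]: "(f :: 'a \<Rightarrow> bit) + f = 0"
  by (simp add: fun_eq_iff)

lemma fun_bit_minus [simp]: "(f :: 'a \<Rightarrow> bit) - g = f + g"
  by (simp add: fun_eq_iff)

lemma fun_bit_add_left_self [simp]: "(f :: 'a \<Rightarrow> bit) + (f + g) = g"
  by (simp flip: add.assoc)

lemma fun_bit_add_eq_0 [simp]: "(f :: 'a \<Rightarrow> bit) + g = 0 \<longleftrightarrow> f = g"
  by (metis fun_bit_add_left_self add_0_right)

lemma bscale_simps [simp]: "bscale 0 f = 0" "bscale 1 f = f"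
  by (simp_all add: bscale_def fun_eq_iff)

lemma ex_bit: "(\<exists>k :: bit. P k) \<longleftrightarrow> P 0 \<or> P 1"
  by (metis bit_not_zero_iff)

definition plane :: "('a \<Rightarrow> bit) \<Rightarrow> ('a \<Rightarrow> bit) \<Rightarrow> ('a \<Rightarrow> bit) set" where
  "plane a b = {0, a, b, a + b}"

lemma span_singleton: "Z2_span {c} = {0, c}"
  by (auto simp: Z2fun.span_insert ex_bit)

lemma span_pair: "Z2_span {a, b} = plane a b"
  unfolding plane_def Z2fun.span_insert[of a] span_singleton ex_bit
  by (auto simp: add.commute[of a])

lemma subspace_plane: "Z2_subspace (plane a b)"
  by (metis span_pair Z2fun.subspace_span)

text \<open>Any two of the three nonzero elements of a plane add up to the third. If
  \<open>a\<close> and \<open>b\<close> are dependent, no such \<open>c\<close> and \<open>d\<close>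
  exist.\<close>

lemma plane_eq:
  assumes "c \<in> plane a b" "d \<in> plane a b" "c \<noteq> d" "c \<noteq> 0" "d \<noteq> 0"
  shows "plane c d = plane a b"
  using assms unfolding plane_def by (auto simp: add.commute add.left_commute)

lemma class_mod_eq: "class_mod c \<rho> = {\<rho>, \<rho> + c}"
  by (auto simp: class_mod_def span_singleton)

lemma class_mod_subset_iff:
  assumes "Z2_subspace K" "c \<in> K"
  shows "class_mod c \<rho> \<subseteq> K \<longleftrightarrow> \<rho> \<in> K"
  using assms Z2fun.subspace_add[of K \<rho> c] by (auto simp: class_mod_eq)

text \<open>Whether a color lies in a subspace \<open>K\<close> containing \<open>c\<close> depends
  only on its class modulo \<open>c\<close>, so congruent multisets have equally many colors in
  \<open>K\<close>.\<close>

lemma mset_cong_mod_card: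
  assumes "mset_cong_mod c (image_mset \<alpha> (mset_set A)) (image_mset \<alpha> (mset_set B))"
    and "Z2_subspace K" "c \<in> K" "finite A" "finite B"
  shows "card {f \<in> A. \<alpha> f \<in> K} = card {f \<in> B. \<alpha> f \<in> K}"
proof -
  have *: "size (filter_mset (\<lambda>C. C \<subseteq> K) (image_mset (class_mod c) (image_mset \<alpha> (mset_set D))))
      = card {f \<in> D. \<alpha> f \<in> K}" if "finite D" for D
    using that by (simp add: filter_mset_image_mset class_mod_subset_iff[OF assms(2,3)])
  show ?thesis
    using *[OF assms(4)] *[OF assms(5)] assms(1) unfolding mset_cong_mod_def by simp
qed

section \<open>Faces of three-independent 1-skeletons\<close>

text \<open>Over the two-element field, independence means that no nonempty subset has sum zero.
  Nonzero colors, \<open>indep2\<close> and \<open>indep3\<close> say this for up to three edges at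
  a vertex.\<close>

locale three_independent_skeleton =
  fixes \<Gamma> :: "('v, 'e) mgraph" and \<alpha> :: "'e \<Rightarrow> bit ^ 'k \<Rightarrow> bit" and n :: nat
  assumes graph: "multigraph \<Gamma>" and valent: "valent n \<Gamma>"
    and color: "\<And>e. e \<in> edges \<Gamma> \<Longrightarrow> \<alpha> e \<in> Hom_Z2 \<and> \<alpha> e \<noteq> 0"
    and cong: "colors_cong \<Gamma> \<alpha>"
    and indep2: "\<And>p e f. p \<in> verts \<Gamma> \<Longrightarrow> e \<in> edges_at \<Gamma> p \<Longrightarrow> f \<in> edges_at \<Gamma> p \<Longrightarrow> e \<noteq> f \<Longrightarrow> \<alpha> e \<noteq> \<alpha> f"
    and indep3: "\<And>p e f g. p \<in> verts \<Gamma> \<Longrightarrow> e \<in> edges_at \<Gamma> p \<Longrightarrow> f \<in> edges_at \<Gamma> p \<Longrightarrow> g \<in> edges_at \<Gamma> p \<Longrightarrow>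
      e \<noteq> f \<Longrightarrow> e \<noteq> g \<Longrightarrow> f \<noteq> g \<Longrightarrow> \<alpha> e + \<alpha> f \<noteq> \<alpha> g"
    and inter: "\<And>F F' i j. face i \<Gamma> \<alpha> F \<Longrightarrow> face j \<Gamma> \<alpha> F' \<Longrightarrow> i < 3 \<Longrightarrow> j < 3 \<Longrightarrow>
      connected_graph (graph_inter F F') \<or> empty_graph (graph_inter F F')"
begin

lemma finite_edges_at: "finite (edges_at \<Gamma> p)"
  using graph by (simp add: multigraph_def edges_at_def)

lemma edge_ends:
  assumes "e \<in> edges \<Gamma>"
  obtains u v where "ends \<Gamma> e = {u, v}" "u \<noteq> v" "u \<in> verts \<Gamma>" "v \<in> verts \<Gamma>"
  using assms graph unfolding multigraph_def card_2_iff by (metis insert_subset)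

lemma edges_at_ends:
  assumes "e \<in> edges_at \<Gamma> p"
  obtains q where "ends \<Gamma> e = {p, q}" "p \<noteq> q" "q \<in> verts \<Gamma>"
proof -
  have e: "e \<in> edges \<Gamma>" "p \<in> ends \<Gamma> e" using assms by (auto simp: edges_at_def)
  obtain u v where uv: "ends \<Gamma> e = {u, v}" "u \<noteq> v" "u \<in> verts \<Gamma>" "v \<in> verts \<Gamma>"
    using edge_ends[OF e(1)] .
  then consider "p = u" | "p = v" using e(2) by auto
  then show thesis
  proof cases
    case 1
    then show thesis using that[of v] uv by simp
  next
    case 2
    then show thesis using that[of u] uv by (simp add: insert_commute)
  qed
qed

text \<open>Makes the number of edges with color in \<open>K\<close> constant along walks that use
  only such edges, whence color components are regular.\<close>

lemma card_edges_at_color: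
  assumes "e \<in> edges \<Gamma>" "ends \<Gamma> e = {u, v}" "Z2_subspace K" "\<alpha> e \<in> K"
  shows "card {f \<in> edges_at \<Gamma> u. \<alpha> f \<in> K} = card {f \<in> edges_at \<Gamma> v. \<alpha> f \<in> K}"
proof (rule mset_cong_mod_card[OF _ assms(3,4) finite_edges_at finite_edges_at])
  show "mset_cong_mod (\<alpha> e) (image_mset \<alpha> (mset_set (edges_at \<Gamma> u))) (image_mset \<alpha> (mset_set (edges_at \<Gamma> v)))"
    using cong assms(1,2) by (simp add: colors_cong_def colors_at_def)
qed

text \<open>The color of a third edge in the plane would be that of \<open>e\<close>, that of
  \<open>f\<close> or their sum; three-independence excludes each.\<close>

lemma edges_at_plane:
  assumes "p \<in> verts \<Gamma>" "e \<in> edges_at \<Gamma> p" "f \<in> edges_at \<Gamma> p" "e \<noteq> f"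
  shows "{g \<in> edges_at \<Gamma> p. \<alpha> g \<in> plane (\<alpha> e) (\<alpha> f)} = {e, f}"
proof -
  have "g = e \<or> g = f" if g: "g \<in> edges_at \<Gamma> p" "\<alpha> g \<in> plane (\<alpha> e) (\<alpha> f)" for g
  proof (rule ccontr)
    assume not: "\<not> (g = e \<or> g = f)"
    then have "\<alpha> g \<noteq> \<alpha> e" "\<alpha> g \<noteq> \<alpha> f" using indep2[OF assms(1)] g(1) assms(2,3) by blast+
    moreover have "\<alpha> g \<noteq> \<alpha> e + \<alpha> f" using indep3[OF assms(1-3) g(1)] assms(4) not by metis
    moreover have "\<alpha> g \<noteq> 0" using color g(1) by (simp add: edges_at_def)
    ultimately show False using g(2) by (auto simp: plane_def)
  qed
  then show ?thesis using assms by (auto simp: plane_def)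
qed

section \<open>Components of the edges with colors in a subspace, and the 2-faces among them\<close>

definition color_step :: "(bit ^ 'k \<Rightarrow> bit) set \<Rightarrow> 'v rel" where
  "color_step K = {(u, v). \<exists>e\<in>edges \<Gamma>. \<alpha> e \<in> K \<and> ends \<Gamma> e = {u, v}}"

definition color_component :: "(bit ^ 'k \<Rightarrow> bit) set \<Rightarrow> 'v \<Rightarrow> ('v, 'e) mgraph" where
  "color_component K p =
     \<lparr>verts = {q. (p, q) \<in> (color_step K)\<^sup>*},
      edges = {e \<in> edges \<Gamma>. \<alpha> e \<in> K \<and> ends \<Gamma> e \<subseteq> {q. (p, q) \<in> (color_step K)\<^sup>*}},
      ends = ends \<Gamma>\<rparr>"

lemma color_component_card:
  assumes "p \<in> verts \<Gamma>" "Z2_subspace K" "q \<in> verts (color_component K p)"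
  shows "q \<in> verts \<Gamma> \<and> card {f \<in> edges_at \<Gamma> q. \<alpha> f \<in> K} = card {f \<in> edges_at \<Gamma> p. \<alpha> f \<in> K}"
proof -
  have "(p, q) \<in> (color_step K)\<^sup>*" using assms(3) by (simp add: color_component_def)
  then show ?thesis
  proof (induction rule: rtrancl_induct)
    case base
    then show ?case using assms(1) by simp
  next
    case (step y z)
    obtain e where e: "e \<in> edges \<Gamma>" "\<alpha> e \<in> K" "ends \<Gamma> e = {y, z}"
      using step(2) by (auto simp: color_step_def)
    have "ends \<Gamma> e \<subseteq> verts \<Gamma>" using e(1) graph by (simp add: multigraph_def)
    then show ?case using e(3) step(3) card_edges_at_color[OF e(1,3) assms(2) e(2)] by simp
  qed
qed

lemma edges_at_color_component:
  assumes "q \<in> verts (color_component K p)"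
  shows "edges_at (color_component K p) q = {f \<in> edges_at \<Gamma> q. \<alpha> f \<in> K}"
proof -
  have q: "(p, q) \<in> (color_step K)\<^sup>*" using assms by (simp add: color_component_def)
  have "ends \<Gamma> f \<subseteq> {q. (p, q) \<in> (color_step K)\<^sup>*}" if f: "f \<in> edges_at \<Gamma> q" "\<alpha> f \<in> K" for f
  proof -
    obtain r where r: "ends \<Gamma> f = {q, r}" using edges_at_ends[OF f(1)] .
    have "f \<in> edges \<Gamma>" using f(1) by (simp add: edges_at_def)
    then have "(q, r) \<in> color_step K" using f(2) r by (auto simp: color_step_def)
    then have "(p, r) \<in> (color_step K)\<^sup>*" using q by (rule rtrancl.rtrancl_into_rtrancl[rotated])
    then show ?thesis using q r by simp
  qed
  then show ?thesis by (auto simp: edges_at_def color_component_def)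
qed

lemma color_component_subgraph:
  assumes "p \<in> verts \<Gamma>" "Z2_subspace K"
  shows "subgraph (color_component K p) \<Gamma>"
proof -
  have "verts (color_component K p) \<subseteq> verts \<Gamma>"
    using color_component_card[OF assms] by blast
  then show ?thesis unfolding subgraph_def by (auto simp: color_component_def)
qed

lemma color_component_connected: "connected_graph (color_component K p)"
proof -
  let ?F = "color_component K p"
  let ?r = "{(u, v). \<exists>e\<in>edges ?F. ends ?F e = {u, v}}"
  have into: "(p, q) \<in> ?r\<^sup>*" if "(p, q) \<in> (color_step K)\<^sup>*" for q
    using that
  proof (induction rule: rtrancl_induct)
    case base
    then show ?case by simp
  next
    case (step y z)
    obtain e where e: "e \<in> edges \<Gamma>" "\<alpha> e \<in> K" "ends \<Gamma> e = {y, z}"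
      using step(2) by (auto simp: color_step_def)
    have "(p, z) \<in> (color_step K)\<^sup>*" using step(1,2) by simp
    then have "e \<in> edges ?F" "ends ?F e = {y, z}"
      using e step(1) by (auto simp: color_component_def)
    then have "(y, z) \<in> ?r" by blast
    then show ?case using step(3) by (rule rtrancl_into_rtrancl[rotated])
  qed
  have "sym ?r" by (auto simp: sym_def insert_commute)
  then have "sym (?r\<^sup>*)" by (rule sym_rtrancl)
  then have "(u, v) \<in> ?r\<^sup>*" if "(p, u) \<in> ?r\<^sup>*" "(p, v) \<in> ?r\<^sup>*" for u v
    using that by (meson symD rtrancl_trans)
  moreover have "p \<in> verts ?F" by (simp add: color_component_def)
  moreover have "(p, q) \<in> ?r\<^sup>*" if "q \<in> verts ?F" for q
    using into that by (simp add: color_component_def)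
  ultimately show ?thesis unfolding connected_graph_def by blast
qed

text \<open>At \<open>p\<close> exactly two edges have color in \<open>K\<close>, and this number is
  constant on the component, which is therefore 2-valent. At each of its vertices the two colors are
  distinct and nonzero, so they span the whole plane \<open>K\<close>.\<close>

lemma two_face_color_component:
  assumes p: "p \<in> verts \<Gamma>" and e: "e \<in> edges_at \<Gamma> p" "f \<in> edges_at \<Gamma> p" "e \<noteq> f"
    and K: "K = plane (\<alpha> e) (\<alpha> f)"
  shows "face 2 \<Gamma> \<alpha> (color_component K p)"
proof -
  let ?F = "color_component K p"
  have subK: "Z2_subspace K" using K subspace_plane by simp
  have "card {g \<in> edges_at \<Gamma> p. \<alpha> g \<in> K} = 2"
    using edges_at_plane[OF p e] e(3) unfolding K by simp
  then have cardF: "card (edges_at ?F q) = 2" and Fv: "q \<in> verts \<Gamma>" if "q \<in> verts ?F" for q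
    using color_component_card[OF p subK that] edges_at_color_component[OF that] by auto
  have two: "\<exists>g h. edges_at ?F q = {g, h} \<and> g \<noteq> h \<and> \<alpha> g \<noteq> \<alpha> h \<and> \<alpha> g \<in> K \<and> \<alpha> h \<in> K \<and> \<alpha> g \<noteq> 0 \<and> \<alpha> h \<noteq> 0"
    if q: "q \<in> verts ?F" for q
  proof -
    obtain g h where gh: "edges_at ?F q = {g, h}" "g \<noteq> h"
      using cardF[OF q] by (auto simp: card_2_iff)
    have "g \<in> edges_at \<Gamma> q \<and> \<alpha> g \<in> K" "h \<in> edges_at \<Gamma> q \<and> \<alpha> h \<in> K"
      using edges_at_color_component[OF q] gh(1) by blast+
    moreover from this have "\<alpha> g \<noteq> 0" "\<alpha> h \<noteq> 0" "\<alpha> g \<noteq> \<alpha> h"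
      using color indep2[OF Fv[OF q]] gh(2) by (auto simp: edges_at_def)
    ultimately show ?thesis using gh by blast
  qed
  have colF: "colors_at ?F \<alpha> q = {#\<alpha> g, \<alpha> h#}" if "edges_at ?F q = {g, h}" "g \<noteq> h" for q g h
    using that by (simp add: colors_at_def)
  have "Z2_span (set_mset (colors_at ?F \<alpha> q)) = K" if q: "q \<in> verts ?F" for q
  proof -
    obtain g h where gh: "edges_at ?F q = {g, h}" "g \<noteq> h" "\<alpha> g \<noteq> \<alpha> h" "\<alpha> g \<in> K" "\<alpha> h \<in> K" "\<alpha> g \<noteq> 0" "\<alpha> h \<noteq> 0"
      using two[OF q] by blast
    have "plane (\<alpha> g) (\<alpha> h) = K"
      using plane_eq[of "\<alpha> g" "\<alpha> e" "\<alpha> f" "\<alpha> h"] gh unfolding K by blast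
    then show ?thesis using colF[OF gh(1,2)] span_pair[of "\<alpha> g" "\<alpha> h"] by simp
  qed
  moreover have "K \<subseteq> Hom_Z2"
    using e color subspace_Hom_Z2 Z2fun.subspace_add[OF subspace_Hom_Z2] Z2fun.subspace_0[OF subspace_Hom_Z2]
    unfolding K plane_def by (auto simp: edges_at_def)
  moreover have "colors_cong ?F \<alpha>"
    unfolding colors_cong_def
  proof (intro ballI allI impI)
    fix d u v assume d: "d \<in> edges ?F" "ends ?F d = {u, v}"
    \<comment> \<open>The quotient of \<open>K\<close> by the color of \<open>d\<close> has two
      classes. At either end, \<open>d\<close> contributes the zero class and the other edge of the
      component the nonzero one, so the two ends agree.\<close>
    have end_class: "image_mset (class_mod (\<alpha> d)) (colors_at ?F \<alpha> w) = {#{0, \<alpha> d}, K - {0, \<alpha> d}#}"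
      if w: "w \<in> ends ?F d" for w
    proof -
      have wF: "w \<in> verts ?F" "d \<in> edges_at ?F w"
        using w d(1) by (auto simp: color_component_def edges_at_def)
      obtain g h where gh: "edges_at ?F w = {g, h}" "g \<noteq> h" "\<alpha> g \<noteq> \<alpha> h" "\<alpha> g \<in> K" "\<alpha> h \<in> K" "\<alpha> g \<noteq> 0" "\<alpha> h \<noteq> 0"
        using two[OF wF(1)] by blast
      have cls: "{#class_mod x x, class_mod x y#} = {#{0, x}, K - {0, x}#}"
        if xy: "x \<in> K" "y \<in> K" "x \<noteq> y" "x \<noteq> 0" "y \<noteq> 0" for x y
      proof -
        have "K = {0, x, y, x + y}"
          using plane_eq[of x "\<alpha> e" "\<alpha> f" y] xy unfolding K by (simp add: plane_def)
        moreover have "x + y \<noteq> 0" "x + y \<noteq> x" using xy by auto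
        ultimately show ?thesis using xy by (auto simp: class_mod_eq add.commute)
      qed
      have "d = g \<or> d = h" using wF(2) gh(1) by auto
      then show ?thesis
        using colF[OF gh(1,2)] cls[of "\<alpha> g" "\<alpha> h"] cls[of "\<alpha> h" "\<alpha> g"] gh(3-)
        by (auto simp: add_mset_commute)
    qed
    show "mset_cong_mod (\<alpha> d) (colors_at ?F \<alpha> u) (colors_at ?F \<alpha> v)"
      unfolding mset_cong_mod_def using end_class[of u] end_class[of v] d(2) by simp
  qed
  moreover have "valent 2 ?F" using cardF by (simp add: valent_def)
  ultimately show ?thesis
    unfolding face_def
    using color_component_subgraph[OF p subK] color_component_connected subK by blast
qed

section \<open>Edges as 1-faces, and consequences of the hypothesis on intersections\<close>

lemma edge_face:
  assumes "e \<in> edges \<Gamma>"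
  shows "face 1 \<Gamma> \<alpha> \<lparr>verts = ends \<Gamma> e, edges = {e}, ends = ends \<Gamma>\<rparr>"
proof -
  let ?F = "\<lparr>verts = ends \<Gamma> e, edges = {e}, ends = ends \<Gamma>\<rparr>"
  obtain u v where uv: "ends \<Gamma> e = {u, v}" "u \<noteq> v" "u \<in> verts \<Gamma>" "v \<in> verts \<Gamma>"
    using edge_ends[OF assms] .
  have at: "edges_at ?F q = {e}" if "q \<in> ends \<Gamma> e" for q
    using that by (auto simp: edges_at_def)
  have col: "colors_at ?F \<alpha> q = {#\<alpha> e#}" if "q \<in> ends \<Gamma> e" for q
    using at[OF that] by (simp add: colors_at_def)
  have "subgraph ?F \<Gamma>" using uv assms by (simp add: subgraph_def)
  moreover have "connected_graph ?F"
    unfolding connected_graph_def using uv by (auto simp: insert_commute)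
  moreover have "valent 1 ?F" using at by (simp add: valent_def)
  moreover have "Z2_subspace (Z2_span {\<alpha> e})" by simp
  moreover have "Z2_span {\<alpha> e} \<subseteq> Hom_Z2"
    using color[OF assms] by (intro Z2fun.span_minimal subspace_Hom_Z2) simp
  moreover have "\<forall>q\<in>verts ?F. Z2_span (set_mset (colors_at ?F \<alpha> q)) = Z2_span {\<alpha> e}"
    using col by simp
  moreover have "colors_cong ?F \<alpha>"
    unfolding colors_cong_def mset_cong_mod_def using col by auto
  ultimately show ?thesis unfolding face_def by blast
qed

text \<open>Otherwise \<open>F\<close> and the 1-face of \<open>e\<close> would meet in two vertices
  and no edge, which is neither connected nor empty. Faces of dimension below 3 are thus induced
  subgraphs.\<close>

lemma edge_in_face:
  assumes F: "face i \<Gamma> \<alpha> F" "i < 3" and e: "e \<in> edges \<Gamma>" "ends \<Gamma> e \<subseteq> verts F"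
  shows "e \<in> edges F"
proof (rule ccontr)
  assume "e \<notin> edges F"
  let ?I = "graph_inter F \<lparr>verts = ends \<Gamma> e, edges = {e}, ends = ends \<Gamma>\<rparr>"
  obtain u v where uv: "ends \<Gamma> e = {u, v}" "u \<noteq> v"
    using edge_ends[OF e(1)] .
  have I: "u \<in> verts ?I" "v \<in> verts ?I" "edges ?I = {}"
    using e(2) uv \<open>e \<notin> edges F\<close> by (auto simp: graph_inter_def)
  then have "connected_graph ?I"
    using inter[OF F(1) edge_face[OF e(1)] F(2)] by (auto simp: empty_graph_def)
  then have "(u, v) \<in> {(x, y). \<exists>e\<in>edges ?I. ends ?I e = {x, y}}\<^sup>*"
    using I(1,2) by (simp add: connected_graph_def)
  then show False using uv(2) I(3) by simp
qed

text \<open>The 1-face of \<open>f\<close> is induced, so it contains every edge parallel to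
  \<open>f\<close>.\<close>

lemma simple_graph:
  assumes "e \<in> edges \<Gamma>" "f \<in> edges \<Gamma>" "ends \<Gamma> e = ends \<Gamma> f"
  shows "e = f"
  using edge_in_face[OF edge_face[OF assms(2)] _ assms(1)] assms(3) by simp

text \<open>The last clause records the plane that colors the face; two faces are compared through
  their planes.\<close>

lemma two_face_exists:
  assumes p: "p \<in> verts \<Gamma>" and e: "e \<in> edges_at \<Gamma> p" "f \<in> edges_at \<Gamma> p" "e \<noteq> f"
  obtains F where "face 2 \<Gamma> \<alpha> F" "p \<in> verts F" "edges_at F p = {e, f}"
    "\<forall>q\<in>verts F. edges_at F q = {g \<in> edges_at \<Gamma> q. \<alpha> g \<in> plane (\<alpha> e) (\<alpha> f)}"
proof -
  let ?K = "plane (\<alpha> e) (\<alpha> f)"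
  have "p \<in> verts (color_component ?K p)" by (simp add: color_component_def)
  moreover from this have "edges_at (color_component ?K p) p = {e, f}"
    using edges_at_color_component edges_at_plane[OF p e] by simp
  ultimately show thesis
    using that[of "color_component ?K p"] two_face_color_component[OF p e] edges_at_color_component
    by simp
qed

text \<open>The intersection is connected, so it contains a walk from \<open>s\<close> to
  \<open>t\<close>. At no vertex do the faces share two edges, so this walk cannot get beyond a
  single edge.\<close>

lemma two_faces_common_vertex:
  assumes F: "face 2 \<Gamma> \<alpha> F" "\<forall>q\<in>verts F. edges_at F q = {g \<in> edges_at \<Gamma> q. \<alpha> g \<in> plane a b}"
    and F': "face 2 \<Gamma> \<alpha> F'" "\<forall>q\<in>verts F'. edges_at F' q = {g \<in> edges_at \<Gamma> q. \<alpha> g \<in> plane a' b'}"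
    and s: "s \<in> verts F" "s \<in> verts F'" "edges_at F s \<noteq> edges_at F' s"
    and t: "t \<in> verts F" "t \<in> verts F'" "t \<noteq> s"
  shows "\<exists>g\<in>edges_at F s. ends \<Gamma> g = {s, t}"
proof -
  have ends: "ends F = ends \<Gamma>" "ends F' = ends \<Gamma>" "verts F \<subseteq> verts \<Gamma>" "edges F \<subseteq> edges \<Gamma>"
    using F(1) F'(1) by (auto simp: face_def subgraph_def)
  \<comment> \<open>Two common edges at \<open>q\<close> have distinct nonzero colors in both
    planes, which then coincide; but then both faces would have the same edges at
    \<open>s\<close>.\<close>
  have uniq: "g = h"
    if q: "q \<in> verts F" "q \<in> verts F'" and gh: "g \<in> edges_at F q \<inter> edges_at F' q" "h \<in> edges_at F q \<inter> edges_at F' q"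
    for q g h
  proof (rule ccontr)
    assume "g \<noteq> h"
    have gh': "g \<in> edges_at \<Gamma> q" "h \<in> edges_at \<Gamma> q" "\<alpha> g \<in> plane a b" "\<alpha> h \<in> plane a b"
      "\<alpha> g \<in> plane a' b'" "\<alpha> h \<in> plane a' b'"
      using gh bspec[OF F(2) q(1)] bspec[OF F'(2) q(2)] by auto
    have "q \<in> verts \<Gamma>" using q ends(3) by blast
    then have "\<alpha> g \<noteq> \<alpha> h" using indep2 gh'(1,2) \<open>g \<noteq> h\<close> by blast
    moreover have "\<alpha> g \<noteq> 0" "\<alpha> h \<noteq> 0" using color gh'(1,2) by (auto simp: edges_at_def)
    ultimately have "plane a b = plane a' b'"
      using plane_eq[of "\<alpha> g" a b "\<alpha> h"] plane_eq[of "\<alpha> g" a' b' "\<alpha> h"] gh'(3-) by simp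
    then show False using s bspec[OF F(2) s(1)] bspec[OF F'(2) s(2)] by simp
  qed
  let ?I = "graph_inter F F'"
  let ?r = "{(x, y). \<exists>e\<in>edges ?I. ends ?I e = {x, y}}"
  have edge_I: "e \<in> edges_at F x \<inter> edges_at F' x \<and> e \<in> edges_at F y \<inter> edges_at F' y \<and> ends \<Gamma> e = {x, y}"
    if "e \<in> edges ?I" "ends ?I e = {x, y}" for e x y
    using that ends by (auto simp: graph_inter_def edges_at_def)
  have I: "verts ?I = verts F \<inter> verts F'" by (simp add: graph_inter_def)
  then have "connected_graph ?I"
    using inter[OF F(1) F'(1)] s by (auto simp: empty_graph_def)
  then have "(s, t) \<in> ?r\<^sup>*" using s t I by (simp add: connected_graph_def)
  then obtain u where u: "(s, u) \<in> ?r" "(u, t) \<in> ?r\<^sup>*"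
    using t(3) by (cases rule: converse_rtranclE) auto
  then obtain e where e: "e \<in> edges ?I" "ends ?I e = {s, u}" by blast
  have "{s, u} \<subseteq> verts F" "{s, u} \<subseteq> verts F'"
    using e F(1) F'(1) ends by (auto simp: face_def subgraph_def graph_inter_def)
  then have uF: "u \<in> verts F" "u \<in> verts F'" by auto
  \<comment> \<open>At \<open>s\<close> and at \<open>u\<close> the only common edge is
    \<open>e\<close>, so the walk goes back and forth along \<open>e\<close>.\<close>
  have "w \<in> {s, u}" if "(u, w) \<in> ?r\<^sup>*" for w
    using that
  proof (induction rule: rtrancl_induct)
    case base
    then show ?case by simp
  next
    case (step y z)
    then obtain f where f: "f \<in> edges ?I" "ends ?I f = {y, z}" by blast
    have "y \<in> verts F" "y \<in> verts F'" using step(3) s uF by auto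
    moreover have "e \<in> edges_at F y \<inter> edges_at F' y" using edge_I[OF e] step(3) by auto
    ultimately have "f = e" using uniq edge_I[OF f] by blast
    then show ?case using edge_I[OF f] edge_I[OF e] by auto
  qed
  then have "t = u" using u(2) t(3) by blast
  then show ?thesis using edge_I[OF e] by blast
qed

section \<open>Minimal separators\<close>

text \<open>
  Otherwise \<open>e\<close> is the only edge of \<open>F\<close> leaving \<open>verts F \<inter> A\<close>, and the degrees in \<open>F\<close> of these
  vertices, all equal to 2, have an odd sum.
\<close>

lemma two_face_meets_separator_again:
  assumes F: "face 2 \<Gamma> \<alpha> F" "s \<in> verts F" "edges_at F s = {e, f}"
    and sep: "separation (adj \<Gamma>) (verts \<Gamma>) A S B" "s \<in> S"
    and e: "ends \<Gamma> e = {s, a}" "a \<in> A" and f: "ends \<Gamma> f = {s, b}" "b \<in> B"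
  shows "\<exists>t\<in>verts F. t \<in> S \<and> t \<noteq> s"
proof (rule ccontr)
  assume not: "\<not> ?thesis"
  have subF: "subgraph F \<Gamma>" and val: "valent 2 F" using F(1) by (simp_all add: face_def)
  have F': "verts F \<subseteq> verts \<Gamma>" "edges F \<subseteq> edges \<Gamma>" "ends F = ends \<Gamma>"
    and Fends: "\<And>d. d \<in> edges F \<Longrightarrow> ends \<Gamma> d \<subseteq> verts F"
    and Fval: "\<And>q. q \<in> verts F \<Longrightarrow> card (edges_at F q) = 2"
    using subF val unfolding subgraph_def valent_def by metis+
  have fin: "finite (verts F)" "finite (edges F)"
    using F'(1,2) graph finite_subset unfolding multigraph_def by blast+
  let ?A = "verts F \<inter> A"
  have sA: "s \<notin> A" and bA: "b \<notin> A" using sep f(2) by (auto simp: separation_def)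
  have eF: "e \<in> edges F" using F(3) by (auto simp: edges_at_def)
  have aF: "a \<in> verts F" using Fends[OF eF] e(1) by auto
  have ce: "card {v \<in> ?A. v \<in> ends \<Gamma> e} = 1"
  proof -
    have "{v \<in> ?A. v \<in> ends \<Gamma> e} = {a}" using e aF sA by auto
    then show ?thesis by simp
  qed
  have cd: "even (card {v \<in> ?A. v \<in> ends \<Gamma> d})" if d: "d \<in> edges F" "d \<noteq> e" for d
  proof -
    have "d \<in> edges \<Gamma>" using F'(2) d(1) by blast
    then obtain u v where uv: "ends \<Gamma> d = {u, v}" "u \<noteq> v"
      by (rule edge_ends)
    have uvF: "u \<in> verts F" "v \<in> verts F" using Fends[OF d(1)] uv by auto
    have adj: "(u, v) \<in> adj \<Gamma>" "(v, u) \<in> adj \<Gamma>"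
      using d(1) uv F'(2) unfolding adj_def by (auto simp: insert_commute)
    \<comment> \<open>Leaving \<open>A\<close> means entering \<open>S\<close>, in \<open>F\<close>
      only at \<open>s\<close>. There the edges of \<open>F\<close> are \<open>e\<close>, which is
      excluded, and \<open>f\<close>, whose other end lies in \<open>B\<close>.\<close>
    have out: "w \<in> A" if w: "x \<in> ?A" "w \<in> verts F" "(x, w) \<in> adj \<Gamma>" "ends \<Gamma> d = {x, w}" for x w
    proof (rule ccontr)
      assume "w \<notin> A"
      then have "w \<in> S"
        using w F'(1) sep(1) unfolding separation_def by blast
      then have "w = s" using not w(2) by blast
      then have "d \<in> edges_at F s" using d(1) w(4) F'(3) by (simp add: edges_at_def)
      then have "d = f" using F(3) d(2) by blast
      then have "x = b" using w(4) f(1) \<open>w = s\<close> w(1) sA by (auto simp: doubleton_eq_iff)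
      then show False using w(1) bA by blast
    qed
    consider "{x \<in> ?A. x \<in> ends \<Gamma> d} = {}" | "{x \<in> ?A. x \<in> ends \<Gamma> d} = {u, v}"
      using out[of u v] out[of v u] uv(1) uvF adj by (auto simp: insert_commute)
    then show ?thesis
    proof cases
      case 1
      then show ?thesis by (simp only: card.empty even_zero)
    next
      case 2
      have "card {u, v} = 2" using uv(2) by simp
      then show ?thesis unfolding 2 by simp
    qed
  qed
  define c where "c = (\<Sum>d\<in>edges F - {e}. card {v \<in> ?A. v \<in> ends \<Gamma> d})"
  \<comment> \<open>Double counting of incidences: \<open>e\<close> contributes 1, and every other
    edge of \<open>F\<close> contributes 0 or 2.\<close>
  have "(\<Sum>v\<in>?A. 2) = (\<Sum>v\<in>?A. card {d \<in> edges F. v \<in> ends \<Gamma> d})"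
    using F'(3) Fval by (intro sum.cong) (auto simp: edges_at_def)
  also have "\<dots> = (\<Sum>d\<in>edges F. card {v \<in> ?A. v \<in> ends \<Gamma> d})"
    by (rule sum_multicount_gen) (use fin in auto)
  also have "\<dots> = 1 + c"
    using sum.remove[OF fin(2) eF, of "\<lambda>d. card {v \<in> ?A. v \<in> ends \<Gamma> d}"] ce by (simp add: c_def)
  finally have "2 * card ?A = 1 + c" by simp
  moreover have "even c"
    unfolding c_def using cd by (intro dvd_sum) auto
  ultimately show False by presburger
qed

lemma separator_large:
  assumes conn: "connected_graph \<Gamma>" and sep0: "separation (adj \<Gamma>) (verts \<Gamma>) A0 S0 B0"
  shows "n \<le> card S0"
proof -
  \<comment> \<open>A separation with the fewest separating vertices; bounding its \<open>S\<close>
    bounds \<open>S0\<close> as well.\<close>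
  obtain A S B where sep: "separation (adj \<Gamma>) (verts \<Gamma>) A S B"
    and min: "\<And>A' S' B'. separation (adj \<Gamma>) (verts \<Gamma>) A' S' B' \<Longrightarrow> card S \<le> card S'"
  proof -
    let ?P = "\<lambda>(A, S, B). separation (adj \<Gamma>) (verts \<Gamma>) A S B"
    let ?m = "\<lambda>(A, S, B). card S"
    obtain T where T: "?P T" "\<forall>T'. ?P T' \<longrightarrow> ?m T \<le> ?m T'"
      using ex_has_least_nat[of ?P "(A0, S0, B0)" ?m] sep0 by auto
    obtain A S B where "T = (A, S, B)" by (cases T)
    then show thesis using that[of A S B] T by force
  qed
  have finV: "finite (verts \<Gamma>)" using graph by (simp add: multigraph_def)
  have part: "A \<union> S \<union> B = verts \<Gamma>" "A \<inter> S = {}" "A \<inter> B = {}" "S \<inter> B = {}"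
    using sep by (auto simp: separation_def)
  then have finS: "finite S" using finV by (metis finite_Un)
  obtain s where s: "s \<in> S" using separator_nonempty[OF graph conn sep] by blast
  then have sV: "s \<in> verts \<Gamma>" using part by blast
  define edges_to where "edges_to C = {e \<in> edges_at \<Gamma> s. \<exists>c\<in>C. ends \<Gamma> e = {s, c}}" for C
  have to_sub: "edges_to C \<subseteq> edges_at \<Gamma> s" for C by (auto simp: edges_to_def)
  have fin_to: "finite (edges_to C)" for C
    using to_sub finite_edges_at by (rule finite_subset)
  have to_disj: "edges_to C \<inter> edges_to D = {}" if "C \<inter> D = {}" for C D
    using that unfolding edges_to_def by (auto simp: doubleton_eq_iff)
  have to_nonempty: "edges_to C \<noteq> {}" if "\<exists>c\<in>C. (s, c) \<in> adj \<Gamma>" for C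
    using that unfolding edges_to_def adj_def edges_at_def by blast
  \<comment> \<open>By minimality every vertex of \<open>S\<close> has neighbours on both sides. The
    final count needs both numbers to be positive.\<close>
  have "edges_to A \<noteq> {}"
    by (rule to_nonempty, rule minimal_separation_neighbour[OF separation_sym[OF sym_adj sep] finV min s])
  moreover have "edges_to B \<noteq> {}"
    by (rule to_nonempty, rule minimal_separation_neighbour[OF sep finV min s])
  ultimately have pos: "card (edges_to A) \<noteq> 0" "card (edges_to B) \<noteq> 0" using fin_to by auto
  have E: "edges_at \<Gamma> s = edges_to A \<union> edges_to B \<union> edges_to S"
  proof (rule equalityI; rule subsetI)
    fix e assume e: "e \<in> edges_at \<Gamma> s"
    obtain q where "ends \<Gamma> e = {s, q}" "q \<in> verts \<Gamma>" using edges_at_ends[OF e] .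
    then show "e \<in> edges_to A \<union> edges_to B \<union> edges_to S"
      using e part(1) unfolding edges_to_def by auto
  qed (use to_sub in blast)
  have "n = card (edges_at \<Gamma> s)" using valent sV by (simp add: valent_def)
  then have deg: "n = card (edges_to A) + card (edges_to B) + card (edges_to S)"
    using fin_to to_disj[OF part(2)] to_disj[OF part(3)] to_disj[OF part(4)] unfolding E
    by (subst (asm) card_Un_disjoint; simp add: card_Un_disjoint Int_Un_distrib Int_Un_distrib2 Int_commute)
  \<comment> \<open>Only the vertex is chosen as a function of \<open>e\<close> and
    \<open>f\<close>; a face through it is recovered from this predicate when needed.\<close>
  define on_face where "on_face e f F v \<longleftrightarrow> face 2 \<Gamma> \<alpha> F \<and> s \<in> verts F \<and> v \<in> verts F \<and>
      edges_at F s = {e, f} \<and>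
      (\<forall>q\<in>verts F. edges_at F q = {g \<in> edges_at \<Gamma> q. \<alpha> g \<in> plane (\<alpha> e) (\<alpha> f)})" for e f F v
  have "\<exists>v. v \<in> S \<and> v \<noteq> s \<and> (\<exists>F. on_face e f F v)"
    if ef: "e \<in> edges_to A" "f \<in> edges_to B" for e f
  proof -
    have at_s: "e \<in> edges_at \<Gamma> s" "f \<in> edges_at \<Gamma> s" "e \<noteq> f"
      using ef to_sub to_disj[OF part(3)] by blast+
    obtain F where F: "face 2 \<Gamma> \<alpha> F" "s \<in> verts F" "edges_at F s = {e, f}"
      "\<forall>q\<in>verts F. edges_at F q = {g \<in> edges_at \<Gamma> q. \<alpha> g \<in> plane (\<alpha> e) (\<alpha> f)}"
      by (rule two_face_exists[OF sV at_s])
    obtain a b where "a \<in> A" "ends \<Gamma> e = {s, a}" "b \<in> B" "ends \<Gamma> f = {s, b}"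
      using ef by (auto simp: edges_to_def)
    then obtain v where "v \<in> verts F" "v \<in> S" "v \<noteq> s"
      using two_face_meets_separator_again[OF F(1-3) sep s] by blast
    moreover from this have "on_face e f F v" using F by (simp add: on_face_def)
    ultimately show ?thesis by blast
  qed
  then obtain t where t: "\<And>e f. e \<in> edges_to A \<Longrightarrow> f \<in> edges_to B \<Longrightarrow>
      t e f \<in> S \<and> t e f \<noteq> s \<and> (\<exists>F. on_face e f F (t e f))"
    by metis
  have not_to_S: "g \<notin> {e, f}" if "e \<in> edges_to A" "f \<in> edges_to B" "g \<in> edges_to S" for e f g
    using that to_disj[OF part(2)] to_disj[OF part(4)] by blast
  have to_S: "g \<in> edges_to S" if "g \<in> edges_at \<Gamma> s" "ends \<Gamma> g = {s, u}" "u \<in> S" for g u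
    using that by (auto simp: edges_to_def)
  \<comment> \<open>If two choices agree, two different 2-faces at \<open>s\<close> share this
    further vertex, so an edge from \<open>s\<close> to it is \<open>e\<close> or \<open>f\<close>.
    These edges end in \<open>A\<close> and \<open>B\<close>, the vertex lies in
    \<open>S\<close>.\<close>
  have inj_t: "inj_on (\<lambda>(e, f). t e f) (edges_to A \<times> edges_to B)"
  proof (rule inj_onI, clarify, rule ccontr)
    fix e f e' f'
    assume ef: "e \<in> edges_to A" "f \<in> edges_to B" "e' \<in> edges_to A" "f' \<in> edges_to B"
      and eq: "t e f = t e' f'" and ne: "\<not> (e = e' \<and> f = f')"
    obtain F where F: "face 2 \<Gamma> \<alpha> F" "s \<in> verts F" "t e f \<in> verts F" "edges_at F s = {e, f}"
      "\<forall>q\<in>verts F. edges_at F q = {g \<in> edges_at \<Gamma> q. \<alpha> g \<in> plane (\<alpha> e) (\<alpha> f)}"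
      using t[OF ef(1,2)] unfolding on_face_def by blast
    obtain F' where F': "face 2 \<Gamma> \<alpha> F'" "s \<in> verts F'" "t e' f' \<in> verts F'" "edges_at F' s = {e', f'}"
      "\<forall>q\<in>verts F'. edges_at F' q = {g \<in> edges_at \<Gamma> q. \<alpha> g \<in> plane (\<alpha> e') (\<alpha> f')}"
      using t[OF ef(3,4)] unfolding on_face_def by blast
    \<comment> \<open>This rules out that \<open>{e, f}\<close> and \<open>{e', f'}\<close> agree
      crosswise.\<close>
    have "e \<noteq> f'" "e' \<noteq> f" using ef to_disj[OF part(3)] by blast+
    then have "edges_at F s \<noteq> edges_at F' s" using F(4) F'(4) ne by (auto simp: doubleton_eq_iff)
    then obtain g where g: "g \<in> edges_at F s" "ends \<Gamma> g = {s, t e f}"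
      using two_faces_common_vertex[OF F(1,5) F'(1,5) F(2) F'(2), of "t e f"] F(3) F'(3) eq
        t[OF ef(1,2)] by auto
    then have "g \<in> {e, f}" using F(4) by simp
    then have "g \<in> edges_at \<Gamma> s" using ef to_sub by blast
    then show False using to_S[OF _ g(2)] t[OF ef(1,2)] not_to_S[OF ef(1,2)] \<open>g \<in> {e, f}\<close> by blast
  qed
  have "\<exists>u. u \<in> S \<and> ends \<Gamma> g = {s, u}" if "g \<in> edges_to S" for g
    using that by (auto simp: edges_to_def)
  then obtain u where u: "\<And>g. g \<in> edges_to S \<Longrightarrow> u g \<in> S \<and> ends \<Gamma> g = {s, u g}" by metis
  have inj_u: "inj_on u (edges_to S)"
  proof (rule inj_onI)
    fix g h assume gh: "g \<in> edges_to S" "h \<in> edges_to S" "u g = u h"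
    then have "ends \<Gamma> g = ends \<Gamma> h" using u by simp
    moreover have "g \<in> edges \<Gamma>" "h \<in> edges \<Gamma>" using gh to_sub by (auto simp: edges_at_def)
    ultimately show "g = h" using simple_graph by blast
  qed
  have us: "u g \<noteq> s" if g: "g \<in> edges_to S" for g
  proof -
    have "g \<in> edges_at \<Gamma> s" using to_sub g by blast
    then obtain r where "ends \<Gamma> g = {s, r}" "s \<noteq> r" by (rule edges_at_ends)
    then show ?thesis using u[OF g] by auto
  qed
  let ?T = "(\<lambda>(e, f). t e f) ` (edges_to A \<times> edges_to B)"
  \<comment> \<open>If \<open>t e f\<close> were adjacent to \<open>s\<close>, the joining edge
    would belong to the induced face and be \<open>e\<close> or \<open>f\<close>, neither of which
    ends in \<open>S\<close>.\<close>
  have disj: "?T \<inter> u ` edges_to S = {}"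
  proof (rule ccontr)
    assume "?T \<inter> u ` edges_to S \<noteq> {}"
    then obtain e f g where efg: "e \<in> edges_to A" "f \<in> edges_to B" "g \<in> edges_to S" "t e f = u g"
      by auto
    obtain F where F: "face 2 \<Gamma> \<alpha> F" "s \<in> verts F" "t e f \<in> verts F" "edges_at F s = {e, f}"
      using t[OF efg(1,2)] unfolding on_face_def by blast
    have g: "g \<in> edges \<Gamma>" "ends \<Gamma> g = {s, u g}" using efg(3) to_sub u by (auto simp: edges_at_def)
    then have "g \<in> edges F" using edge_in_face[OF F(1), of g] F(2,3) efg(4) by simp
    moreover have "ends F = ends \<Gamma>" using F(1) by (simp add: face_def subgraph_def)
    ultimately have "g \<in> edges_at F s" using g(2) by (simp add: edges_at_def)
    then show False using F(4) not_to_S[OF efg(1-3)] by blast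
  qed
  have "?T \<subseteq> S - {s}" using t by auto
  moreover have "u ` edges_to S \<subseteq> S - {s}" using u us by blast
  ultimately have "?T \<union> u ` edges_to S \<subseteq> S - {s}" by blast
  then have "card (?T \<union> u ` edges_to S) \<le> card (S - {s})"
    using finS by (intro card_mono) auto
  moreover have "card (?T \<union> u ` edges_to S) = card (edges_to A) * card (edges_to B) + card (edges_to S)"
    using disj fin_to by (simp add: card_Un_disjoint card_image inj_t inj_u card_cartesian_product)
  moreover have "card (S - {s}) = card S - 1" "card S \<noteq> 0" using s finS by auto
  \<comment> \<open>This is \<open>(x - 1) * (y - 1) \<ge> 0\<close> for the positive numbers
    \<open>x\<close> and \<open>y\<close> of edges into \<open>A\<close> and
    \<open>B\<close>.\<close>
  moreover have "card (edges_to A) + card (edges_to B) \<le> card (edges_to A) * card (edges_to B) + 1"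
    using pos by (cases "card (edges_to A)"; cases "card (edges_to B)") auto
  ultimately have "n \<le> card S" using deg by linarith
  then show ?thesis using min[OF sep0] by simp
qed

text \<open>A vertex of a simple graph has as many neighbours as edges. The bound is needed to pass
  from separations to paths, since a complete graph has no separation at all.\<close>

lemma card_verts_greater:
  assumes "connected_graph \<Gamma>"
  shows "n < card (verts \<Gamma>)"
proof -
  obtain p where p: "p \<in> verts \<Gamma>" using assms by (auto simp: connected_graph_def)
  have "\<exists>q. ends \<Gamma> e = {p, q} \<and> q \<in> verts \<Gamma> - {p}" if "e \<in> edges_at \<Gamma> p" for e
    by (rule edges_at_ends[OF that]) blast
  then obtain q where q: "\<And>e. e \<in> edges_at \<Gamma> p \<Longrightarrow> ends \<Gamma> e = {p, q e} \<and> q e \<in> verts \<Gamma> - {p}"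
    by metis
  have "inj_on q (edges_at \<Gamma> p)"
  proof (rule inj_onI)
    fix e f assume ef: "e \<in> edges_at \<Gamma> p" "f \<in> edges_at \<Gamma> p" "q e = q f"
    then have "ends \<Gamma> e = ends \<Gamma> f" using q[OF ef(1)] q[OF ef(2)] by simp
    then show "e = f" using ef simple_graph by (simp add: edges_at_def)
  qed
  moreover have "q ` edges_at \<Gamma> p \<subseteq> verts \<Gamma> - {p}" using q by blast
  ultimately have "card (edges_at \<Gamma> p) \<le> card (verts \<Gamma> - {p})"
    using graph by (intro card_inj_on_le[of q]) (simp_all add: multigraph_def)
  moreover have "card (verts \<Gamma> - {p}) < card (verts \<Gamma>)"
    using p graph by (intro card_Diff1_less) (auto simp: multigraph_def)
  ultimately show ?thesis using valent p by (simp add: valent_def)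
qed

end

text \<open>\<open>l_independent\<close> speaks of exactly \<open>l\<close> edges. Since the vertex
  has at least \<open>l\<close> of them, a smaller set \<open>T\<close> extends to such a set and
  inherits its independence.\<close>

lemma l_independent_subset:
  assumes "l_independent l \<Gamma> \<alpha>" "p \<in> verts \<Gamma>" "finite (edges_at \<Gamma> p)" "l \<le> card (edges_at \<Gamma> p)"
    and "T \<subseteq> edges_at \<Gamma> p" "card T \<le> l"
  shows "inj_on \<alpha> T \<and> \<not> Z2_dependent (\<alpha> ` T)"
proof -
  obtain S where S: "T \<subseteq> S" "S \<subseteq> edges_at \<Gamma> p" "card S = l"
    using exists_subset_between[OF assms(6,4,5,3)] by blast
  then have "inj_on \<alpha> S" "\<not> Z2_dependent (\<alpha> ` S)"
    using assms(1,2) unfolding l_independent_def by blast+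
  then show ?thesis
    using S(1) Z2fun.independent_mono[of "\<alpha> ` S" "\<alpha> ` T"] by (auto intro: inj_on_subset)
qed

theorem proposition3p4:
  fixes \<Gamma> :: "('v, 'e) mgraph"
    and \<alpha> :: "'e \<Rightarrow> bit ^ 'k \<Rightarrow> bit"
    and n :: nat
  assumes "abstract_1_skeleton n \<Gamma> \<alpha>"
    and "connected_graph \<Gamma>"
    and "\<exists>l. 3 \<le> l \<and> l \<le> CARD('k) \<and> l_independent l \<Gamma> \<alpha>"
    and "\<And>F F' i j. face i \<Gamma> \<alpha> F \<Longrightarrow> face j \<Gamma> \<alpha> F' \<Longrightarrow> i < 3 \<Longrightarrow> j < 3 \<Longrightarrow>
           connected_graph (graph_inter F F') \<or> empty_graph (graph_inter F F')"
  shows "d_connected n \<Gamma>"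
proof -
  have skel: "multigraph \<Gamma>" "valent n \<Gamma>" "colors_cong \<Gamma> \<alpha>" "CARD('k) \<le> n"
    "\<And>e. e \<in> edges \<Gamma> \<Longrightarrow> \<alpha> e \<in> Hom_Z2 \<and> \<alpha> e \<noteq> 0"
    using assms(1) by (auto simp: abstract_1_skeleton_def)
  obtain l where l: "3 \<le> l" "l \<le> CARD('k)" "l_independent l \<Gamma> \<alpha>" using assms(3) by blast
  \<comment> \<open>Each vertex has degree \<open>n\<close>, and
    \<open>l \<le> CARD('k) \<le> n\<close>, so sets of at most three edges extend to
    \<open>l\<close> edges.\<close>
  have ind: "inj_on \<alpha> T \<and> \<not> Z2_dependent (\<alpha> ` T)"
    if "p \<in> verts \<Gamma>" "T \<subseteq> edges_at \<Gamma> p" "card T \<le> 3" for p T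
    using l_independent_subset[OF l(3) that(1) _ _ that(2)] that(1,3) l(1,2) skel(1,2,4)
    by (simp add: valent_def multigraph_def edges_at_def)
  interpret three_independent_skeleton \<Gamma> \<alpha> n
  proof
    show "multigraph \<Gamma>" "valent n \<Gamma>" "colors_cong \<Gamma> \<alpha>" by (rule skel)+
    show "\<alpha> e \<in> Hom_Z2 \<and> \<alpha> e \<noteq> 0" if "e \<in> edges \<Gamma>" for e by (rule skel(5)[OF that])
    show "\<alpha> e \<noteq> \<alpha> f" if "p \<in> verts \<Gamma>" "e \<in> edges_at \<Gamma> p" "f \<in> edges_at \<Gamma> p" "e \<noteq> f" for p e f
      using ind[of p "{e, f}"] that by auto
    show "\<alpha> e + \<alpha> f \<noteq> \<alpha> g"
      if p: "p \<in> verts \<Gamma>" "e \<in> edges_at \<Gamma> p" "f \<in> edges_at \<Gamma> p" "g \<in> edges_at \<Gamma> p"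
        and ne: "e \<noteq> f" "e \<noteq> g" "f \<noteq> g" for p e f g
    proof
      assume sum: "\<alpha> e + \<alpha> f = \<alpha> g"
      have T: "inj_on \<alpha> {e, f, g}" "\<not> Z2_dependent {\<alpha> e, \<alpha> f, \<alpha> g}"
        using ind[of p "{e, f, g}"] p by (auto simp: card_insert_if)
      \<comment> \<open>Injectivity keeps the three colors distinct, so removing
        \<open>\<alpha> g\<close> leaves the other two, whose span contains it.\<close>
      then have "{\<alpha> e, \<alpha> f, \<alpha> g} - {\<alpha> g} = {\<alpha> e, \<alpha> f}" using ne by auto
      moreover have "\<alpha> g \<in> Z2_span {\<alpha> e, \<alpha> f}"
        unfolding span_pair plane_def sum by simp
      ultimately show False using T(2) unfolding Z2fun.dependent_def by auto
    qed
    show "connected_graph (graph_inter F F') \<or> empty_graph (graph_inter F F')"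
      if "face i \<Gamma> \<alpha> F" "face j \<Gamma> \<alpha> F'" "i < 3" "j < 3" for F F' i j
      by (rule assms(4)[OF that])
  qed
  show ?thesis
    using d_connected_if_no_separation[OF graph card_verts_greater[OF assms(2)]]
      separator_large[OF assms(2)] by blast
qed

end
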